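(* Let $a$ be a quantum multigraph. Then $t(a)\ge 0$ holds for every isolate indifferent, flatly reflection positive and slowly growing graph parameter $t$ if and only if for every $\epsilon>0$ there exists $r\in\mathbb N$ such that $$a+\epsilon\sum_{i=0}^r\frac{1}{i!}K_2^{2i}$$ coincides, up to labels and isolated vertices, with a sum of squares of elements of $\mathcal A_r^0$.
   Context: All graphs are finite, undirected and loopless, but may have multiple edges. A $k$-labeled graph is a graph in which $k$ different vertices are labeled $1,\dots,k$ (a $0$-labeled graph is an unlabeled graph). Let $\mathcal G_k$ be the set of isomorphism classes (respecting labels) of $k$-labeled graphs. The product of $F,G\in\mathcal G_k$ is obtained by taking the disjoint union and identifying vertices with the same label, keeping all edges with multiplicity. This makes $\mathcal G_k$ an abelian monoid whose identity is the graph with vertices $1,\dots,k$ and no edges (the empty graph if $k=0$). Let $\mathcal A_k$ be the monoid algebra of $\mathcal G_k$ over $\mathbb R$. A quantum multigraph is an element of $\mathcal A_0$, i.e. a finite formal real linear combination of unlabeled multigraphs. Let $\mathcal A_k^0\subseteq\mathcal A_k$ be the subalgebra spanned by the $k$-labeled graphs all of whose vertices are labeled; it is the polynomial algebra $\mathbb R[z_{ij}\mid 1\le i<j\le k]$, where $z_{ij}$ is the graph on the labeled vertices $1,\dots,k$ whose only edge is a single edge $ij$. $K_2^j$ denotes the (unlabeled) graph with two vertices and $j$ edges between them. A graph parameter is a map $t:\mathcal G_0\to\mathbb R$; ignoring labels and extending linearly, it defines linear functionals $t:\mathcal A_k\to\mathbb R$ for all $k$. It is isolate indifferent if its value at a graph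 does not change when an isolated vertex is added; flatly reflection positive if $t(b^2)\ge 0$ for all $b\in\mathcal A_k^0$ and all $k$; slowly growing if $\sum_{i=0}^\infty\frac{1}{i!}t(K_2^{2i})<\infty$. Two elements of (possibly different) algebras $\mathcal A_k,\mathcal A_l$ coincide up to labels and isolated vertices if, after forgetting all labels (giving elements of $\mathcal A_0$), they become equal when each graph is identified with every graph obtained from it by adding or removing isolated vertices; i.e. they are equal modulo the linear span of all $G\sqcup K_1-G$, where $G$ ranges over unlabeled multigraphs (including the empty graph) and $K_1$ is the one-vertex graph. *)

theory Defs
  imports "HOL-Analysis.Finite_Function_Topology" "HOL-Library.Multiset"
begin

text \<open>
  A multigraph is a finite vertex set together with a finite multiset of two-element edges.
  A labeled vertex is named by its label: \<open>Lab i\<close> is the vertex with label \<open>i\<close>, and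
  \<open>Unl m\<close> (\<open>m\<close> arbitrary) is an unlabeled vertex. As the unlabeled vertex names are
  infinite in number and only serve up to isomorphism, every finite labeled multigraph occurs.
\<close>

datatype vertex = Lab nat | Unl nat

type_synonym pregraph = "vertex set \<times> vertex set multiset"

abbreviation verts :: "pregraph \<Rightarrow> vertex set" where "verts \<equiv> fst"
abbreviation edges :: "pregraph \<Rightarrow> vertex set multiset" where "edges \<equiv> snd"

definition multigraph :: "pregraph \<Rightarrow> bool" where
  "multigraph G \<longleftrightarrow> finite (verts G) \<and> (\<forall>e\<in>#edges G. e \<subseteq> verts G \<and> card e = 2)"

definition label_iso :: "(vertex \<Rightarrow> vertex) \<Rightarrow> pregraph \<Rightarrow> pregraph \<Rightarrow> bool" where
  "label_iso f G H \<longleftrightarrow> bij_betw f (verts G) (verts H) \<and>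
     (\<forall>v\<in>verts G. \<forall>i. f v = Lab i \<longleftrightarrow> v = Lab i) \<and>
     edges H = image_mset ((`) f) (edges G)"

definition isomorphic :: "pregraph \<Rightarrow> pregraph \<Rightarrow> bool" where
  "isomorphic G H \<longleftrightarrow> multigraph G \<and> multigraph H \<and> (\<exists>f. label_iso f G H)"

definition map_graph :: "(vertex \<Rightarrow> vertex) \<Rightarrow> pregraph \<Rightarrow> pregraph" where
  "map_graph f G = (f ` verts G, image_mset ((`) f) (edges G))"

lemma label_isoI_map:
  assumes "inj_on f (verts G)" "\<And>v i. v \<in> verts G \<Longrightarrow> f v = Lab i \<longleftrightarrow> v = Lab i"
  shows "label_iso f G (map_graph f G)"
  using assms by (auto simp: label_iso_def map_graph_def inj_on_imp_bij_betw)

lemma multigraph_map: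
  assumes "multigraph G" "inj_on f (verts G)"
  shows "multigraph (map_graph f G)"
  using assms unfolding multigraph_def map_graph_def
  by (auto intro: card_image[THEN trans] inj_on_subset)

lemma label_iso_map_graph:
  assumes "label_iso f G H" shows "H = map_graph f G"
  using assms by (auto simp: label_iso_def map_graph_def bij_betw_def prod_eq_iff)

lemma label_iso_inj: "label_iso f G H \<Longrightarrow> inj_on f (verts G)"
  by (auto simp: label_iso_def bij_betw_def)

lemma label_iso_Lab:
  "label_iso f G H \<Longrightarrow> v \<in> verts G \<Longrightarrow> f v = Lab i \<longleftrightarrow> v = Lab i"
  by (auto simp: label_iso_def)

lemma map_graph_cong:
  assumes "multigraph G" "\<And>v. v \<in> verts G \<Longrightarrow> f v = g v"
  shows "map_graph f G = map_graph g G"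
proof -
  have "f ` e = g ` e" if "e \<in># edges G" for e
    using assms that unfolding multigraph_def by (intro image_cong) auto
  then show ?thesis
    using assms(2) by (auto simp: map_graph_def intro!: image_mset_cong)
qed

lemma map_graph_comp: "map_graph f (map_graph g G) = map_graph (\<lambda>v. f (g v)) G"
  by (simp add: map_graph_def image_image multiset.map_comp comp_def)

lemma map_graph_ident: "multigraph G \<Longrightarrow> (\<And>v. v \<in> verts G \<Longrightarrow> f v = v) \<Longrightarrow> map_graph f G = G"
  using map_graph_cong[of G f "\<lambda>v. v"] by (cases G) (simp add: map_graph_def multiset.map_ident_strong)

lemma isomorphicI_map:
  assumes "multigraph G" "inj_on f (verts G)"
    "\<And>v i. v \<in> verts G \<Longrightarrow> f v = Lab i \<longleftrightarrow> v = Lab i"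
  shows "isomorphic G (map_graph f G)"
  using assms label_isoI_map multigraph_map unfolding isomorphic_def by blast

lemma isomorphic_refl: "multigraph G \<Longrightarrow> isomorphic G G"
  using isomorphicI_map[of G "\<lambda>v. v"] by (simp add: map_graph_ident)

lemma isomorphic_sym:
  assumes "isomorphic G H" shows "isomorphic H G"
proof -
  obtain f where f: "label_iso f G H" and G: "multigraph G" and H: "multigraph H"
    using assms unfolding isomorphic_def by blast
  let ?g = "inv_into (verts G) f"
  have HG: "H = map_graph f G" using f by (rule label_iso_map_graph)
  have inj: "inj_on f (verts G)" using f by (rule label_iso_inj)
  have vH: "verts H = f ` verts G" by (simp add: HG map_graph_def)
  have "map_graph ?g H = G"
    unfolding HG map_graph_comp using G inj by (intro map_graph_ident) auto
  moreover have "isomorphic H (map_graph ?g H)"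
  proof (rule isomorphicI_map[OF H])
    show "inj_on ?g (verts H)" unfolding vH by (rule inj_on_inv_into) simp
    show "?g v = Lab i \<longleftrightarrow> v = Lab i" if "v \<in> verts H" for v i
      using that inj label_iso_Lab[OF f] unfolding vH by (auto simp: inv_into_f_f)
  qed
  ultimately show ?thesis by simp
qed

lemma isomorphic_trans:
  assumes "isomorphic G H" "isomorphic H K" shows "isomorphic G K"
proof -
  obtain f g where f: "label_iso f G H" and g: "label_iso g H K" and G: "multigraph G"
    using assms unfolding isomorphic_def by blast
  have HG: "H = map_graph f G" and KH: "K = map_graph g H"
    using f g by (auto dest: label_iso_map_graph)
  have vH: "verts H = f ` verts G" by (simp add: HG map_graph_def)
  have "isomorphic G (map_graph (\<lambda>v. g (f v)) G)"
  proof (rule isomorphicI_map[OF G])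
    show "inj_on (\<lambda>v. g (f v)) (verts G)"
      using comp_inj_on[OF label_iso_inj[OF f]] label_iso_inj[OF g] vH by (auto simp: comp_def)
    show "g (f v) = Lab i \<longleftrightarrow> v = Lab i" if "v \<in> verts G" for v i
      using that label_iso_Lab[OF f, of v i] label_iso_Lab[OF g, of "f v" i] vH by auto
  qed
  then show ?thesis unfolding KH HG map_graph_comp .
qed

quotient_type lgraph = pregraph / partial: isomorphic
proof (rule part_equivpI)
  show "\<exists>G. isomorphic G G"
    using isomorphic_refl[of "({}, {#})"] by (auto simp: multigraph_def)
  show "symp isomorphic" by (intro sympI) (rule isomorphic_sym)
  show "transp isomorphic" by (intro transpI) (rule isomorphic_trans)
qed

text \<open>
  The product is defined for arbitrary pairs of labeled graphs: vertices with the same label are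
  identified, all other vertices are kept disjoint. This makes the disjoint union of the
  monoids of \<open>k\<close>-labeled graphs, over all \<open>k\<close> (and over all other finite label sets), a single
  commutative monoid, of which each of them is a subsemigroup. It is written additively because
  the monoid algebra of an additive monoid \<open>M\<close> is available in the library, as \<open>M \<Rightarrow>\<^sub>0 real\<close>.
\<close>

fun left_vertex :: "vertex \<Rightarrow> vertex" where
  "left_vertex (Lab i) = Lab i"
| "left_vertex (Unl m) = Unl (2 * m)"

fun right_vertex :: "vertex \<Rightarrow> vertex" where
  "right_vertex (Lab i) = Lab i"
| "right_vertex (Unl m) = Unl (2 * m + 1)"

definition union_graph :: "pregraph \<Rightarrow> pregraph \<Rightarrow> pregraph" where
  "union_graph G H = (verts G \<union> verts H, edges G + edges H)"

definition glue :: "pregraph \<Rightarrow> pregraph \<Rightarrow> pregraph" where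
  "glue G H = union_graph (map_graph left_vertex G) (map_graph right_vertex H)"

lemma left_right_simps [simp]:
  "left_vertex v = Lab i \<longleftrightarrow> v = Lab i" "right_vertex v = Lab i \<longleftrightarrow> v = Lab i"
  "left_vertex v = left_vertex w \<longleftrightarrow> v = w" "right_vertex v = right_vertex w \<longleftrightarrow> v = w"
  by (cases v; cases w; auto)+

lemma left_eq_right [simp]:
  "left_vertex v = right_vertex w \<longleftrightarrow> (\<exists>i. v = Lab i \<and> w = Lab i)"
  "right_vertex w = left_vertex v \<longleftrightarrow> (\<exists>i. v = Lab i \<and> w = Lab i)"
  by (cases v; cases w; auto; presburger)+

lemma multigraph_union: "multigraph G \<Longrightarrow> multigraph H \<Longrightarrow> multigraph (union_graph G H)"
  unfolding multigraph_def union_graph_def by auto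

lemma multigraph_glue: "multigraph G \<Longrightarrow> multigraph H \<Longrightarrow> multigraph (glue G H)"
  unfolding glue_def by (intro multigraph_union multigraph_map) (auto intro: inj_onI)

lemma map_union_graph:
  "map_graph f (union_graph G H) = union_graph (map_graph f G) (map_graph f H)"
  by (simp add: map_graph_def union_graph_def image_Un)

text \<open>
  Two gluings of graphs into one agree up to isomorphism as soon as the embeddings identify
  exactly the same vertices.
\<close>

lemma isomorphic_union_maps:
  assumes G: "multigraph G" and H: "multigraph H"
    and p: "inj_on p (verts G)" "\<And>v i. v \<in> verts G \<Longrightarrow> p v = Lab i \<longleftrightarrow> v = Lab i"
    and q: "inj_on q (verts H)" "\<And>v i. v \<in> verts H \<Longrightarrow> q v = Lab i \<longleftrightarrow> v = Lab i"
    and pq: "\<And>v w. v \<in> verts G \<Longrightarrow> w \<in> verts H \<Longrightarrow> p v = q w \<Longrightarrow> \<exists>i. v = Lab i \<and> w = Lab i"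
  shows "isomorphic (glue G H) (union_graph (map_graph p G) (map_graph q H))"
proof -
  define f where "f x = (if x \<in> left_vertex ` verts G then p (inv left_vertex x)
     else q (inv right_vertex x))" for x
  have inj: "inj left_vertex" "inj right_vertex" by (auto intro: injI)
  have fl: "f (left_vertex v) = p v" if "v \<in> verts G" for v
    using that inj by (simp add: f_def)
  have fr: "f (right_vertex w) = q w" if w: "w \<in> verts H" for w
  proof (cases "right_vertex w \<in> left_vertex ` verts G")
    case True
    then obtain i where "w = Lab i" "Lab i \<in> verts G" by auto
    then have "f (right_vertex w) = Lab i"
      using fl[of "Lab i"] p(2)[of "Lab i" i] by simp
    then show ?thesis using q(2)[OF w, of i] \<open>w = Lab i\<close> by simp
  next
    case False
    then show ?thesis using inj by (simp add: f_def)
  qed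
  have vg: "verts (glue G H) = left_vertex ` verts G \<union> right_vertex ` verts H"
    by (simp add: glue_def union_graph_def map_graph_def)
  have "isomorphic (glue G H) (map_graph f (glue G H))"
  proof (rule isomorphicI_map[OF multigraph_glue[OF G H]])
    have A: "left_vertex v = right_vertex w" if vw: "v \<in> verts G" "w \<in> verts H" "p v = q w" for v w
      using pq[OF vw] by auto
    show "inj_on f (verts (glue G H))"
    proof (rule inj_onI)
      fix x y assume x: "x \<in> verts (glue G H)" and y: "y \<in> verts (glue G H)" and eq: "f x = f y"
      consider (1) v where "v \<in> verts G" "x = left_vertex v"
        | (2) w where "w \<in> verts H" "x = right_vertex w" using x unfolding vg by blast
      then show "x = y"
      proof cases
        case v: 1
        consider (1) v' where "v' \<in> verts G" "y = left_vertex v'"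
          | (2) w where "w \<in> verts H" "y = right_vertex w" using y unfolding vg by blast
        then show ?thesis
        proof cases
          case 1
          then have "p v = p v'" using eq v by (simp add: fl)
          then show ?thesis using inj_onD[OF p(1)] v 1 by simp
        next
          case 2
          then have "p v = q w" using eq v by (simp add: fl fr)
          then show ?thesis using A v 2 by blast
        qed
      next
        case w: 2
        consider (1) v where "v \<in> verts G" "y = left_vertex v"
          | (2) w' where "w' \<in> verts H" "y = right_vertex w'" using y unfolding vg by blast
        then show ?thesis
        proof cases
          case 1
          then have "p v = q w" using eq w by (simp add: fl fr)
          then show ?thesis using A[OF 1(1) w(1)] w 1 by simp
        next
          case 2
          then have "q w = q w'" using eq w by (simp add: fr)
          then show ?thesis using inj_onD[OF q(1)] w 2 by simp
        qed
      qed
    qed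
    show "f v = Lab i \<longleftrightarrow> v = Lab i" if "v \<in> verts (glue G H)" for v i
      using that unfolding vg by (elim UnE imageE) (simp_all add: fl fr p q)
  qed
  moreover have "map_graph f (glue G H) = union_graph (map_graph p G) (map_graph q H)"
    unfolding glue_def map_union_graph map_graph_comp
    using map_graph_cong[OF G, of "\<lambda>v. f (left_vertex v)" p] fl
      map_graph_cong[OF H, of "\<lambda>v. f (right_vertex v)" q] fr by simp
  ultimately show ?thesis by simp
qed

lemma isomorphic_glue:
  assumes "isomorphic G G'" "isomorphic H H'"
  shows "isomorphic (glue G H) (glue G' H')"
proof -
  obtain f g where f: "label_iso f G G'" and g: "label_iso g H H'"
    and mg: "multigraph G" "multigraph H"
    using assms unfolding isomorphic_def by blast
  have eq: "G' = map_graph f G" "H' = map_graph g H"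
    using f g by (auto dest: label_iso_map_graph)
  show ?thesis unfolding eq glue_def[of "map_graph f G"] map_graph_comp
    using label_iso_inj[OF f] label_iso_inj[OF g]
    by (intro isomorphic_union_maps mg)
      (auto simp: inj_on_def label_iso_Lab[OF f] label_iso_Lab[OF g])
qed

lemma isomorphic_glue_commute:
  assumes "multigraph G" "multigraph H"
  shows "isomorphic (glue G H) (glue H G)"
proof -
  have "glue H G = union_graph (map_graph right_vertex G) (map_graph left_vertex H)"
    by (simp add: glue_def union_graph_def Un_commute add.commute)
  then show ?thesis
    using isomorphic_union_maps[OF assms, of right_vertex left_vertex] by (auto simp: inj_on_def)
qed

lemma isomorphic_glue_empty:
  assumes "multigraph G" shows "isomorphic (glue ({}, {#}) G) G"
proof -
  have "union_graph (map_graph id ({}, {#})) (map_graph id G) = G"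
    by (simp add: union_graph_def map_graph_def)
  then show ?thesis
    using isomorphic_union_maps[of "({}, {#})" G id id] assms by (auto simp: multigraph_def)
qed

lemma isomorphic_glue_assoc:
  assumes G: "multigraph G" and H: "multigraph H" and K: "multigraph K"
  shows "isomorphic (glue (glue G H) K) (glue G (glue H K))"
proof -
  have mg: "multigraph (glue G H)" using G H by (rule multigraph_glue)
  have vg: "verts (glue G H) = left_vertex ` verts G \<union> right_vertex ` verts H"
    by (simp add: glue_def union_graph_def map_graph_def)
  define p where "p x = (case x of Lab i \<Rightarrow> Lab i
    | Unl m \<Rightarrow> if even m then Unl m else Unl (2 * (m - 1) + 1))" for x
  have pLab: "p (Lab i) = Lab i" for i by (simp add: p_def)
  have pl: "p (left_vertex v) = left_vertex v" for v
    by (cases v) (auto simp: p_def)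
  have pr: "p (right_vertex v) = right_vertex (left_vertex v)" for v
    by (cases v) (auto simp: p_def)
  have "glue G (glue H K) =
    union_graph (map_graph p (glue G H)) (map_graph (\<lambda>v. right_vertex (right_vertex v)) K)"
    unfolding glue_def map_union_graph map_graph_comp pl pr
    by (simp add: union_graph_def Un_assoc add.assoc)
  moreover have "isomorphic (glue (glue G H) K) \<dots>"
    by (rule isomorphic_union_maps[OF mg K]) (auto simp: vg inj_on_def pLab pl pr)
  ultimately show ?thesis by simp
qed

lemma isomorphic_reflD: "isomorphic G G \<Longrightarrow> multigraph G"
  by (simp add: isomorphic_def)

lemma ex_rep_lgraph: "\<exists>G. isomorphic G G \<and> a = abs_lgraph G"
  by (induct a rule: lgraph.abs_induct) blast

lift_definition empty_lgraph :: lgraph is "({}, {#})"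
  by (rule isomorphic_refl) (simp add: multigraph_def)

lift_definition glue_lgraph :: "lgraph \<Rightarrow> lgraph \<Rightarrow> lgraph" is glue
  by (rule isomorphic_glue)

lemma glue_lgraph_assoc: "glue_lgraph (glue_lgraph a b) c = glue_lgraph a (glue_lgraph b c)"
proof -
  obtain G H K where G: "isomorphic G G" and H: "isomorphic H H" and K: "isomorphic K K"
    and eq: "a = abs_lgraph G" "b = abs_lgraph H" "c = abs_lgraph K"
    using ex_rep_lgraph[of a] ex_rep_lgraph[of b] ex_rep_lgraph[of c] by blast
  note m = isomorphic_reflD[OF G] isomorphic_reflD[OF H] isomorphic_reflD[OF K]
  note GH = isomorphic_refl[OF multigraph_glue[OF m(1,2)]]
    and HK = isomorphic_refl[OF multigraph_glue[OF m(2,3)]]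
  note glue = glue_lgraph.abs_eq
  show ?thesis
    unfolding eq glue[OF G H] glue[OF H K] glue[OF GH K] glue[OF G HK]
    by (rule Quotient3_rel_abs[OF Quotient3_lgraph isomorphic_glue_assoc[OF m]])
qed

lemma glue_lgraph_commute: "glue_lgraph a b = glue_lgraph b a"
proof -
  obtain G H where G: "isomorphic G G" and H: "isomorphic H H"
    and eq: "a = abs_lgraph G" "b = abs_lgraph H"
    using ex_rep_lgraph[of a] ex_rep_lgraph[of b] by blast
  note glue = glue_lgraph.abs_eq
  show ?thesis
    unfolding eq glue[OF G H] glue[OF H G]
    by (rule Quotient3_rel_abs[OF Quotient3_lgraph
          isomorphic_glue_commute[OF isomorphic_reflD[OF G] isomorphic_reflD[OF H]]])
qed

lemma glue_lgraph_empty: "glue_lgraph empty_lgraph a = a"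
proof -
  obtain G where G: "isomorphic G G" and eq: "a = abs_lgraph G"
    using ex_rep_lgraph[of a] by blast
  have E: "isomorphic ({}, {#}) ({}, {#})"
    by (rule isomorphic_refl) (simp add: multigraph_def)
  show ?thesis
    unfolding eq empty_lgraph_def glue_lgraph.abs_eq[OF E G]
    by (rule Quotient3_rel_abs[OF Quotient3_lgraph isomorphic_glue_empty[OF isomorphic_reflD[OF G]]])
qed

instantiation lgraph :: comm_monoid_add
begin

definition "0 = empty_lgraph"
definition "G + H = glue_lgraph G H"

instance
  by standard
    (simp_all only: plus_lgraph_def zero_lgraph_def glue_lgraph_assoc glue_lgraph_empty,
      rule glue_lgraph_commute)

end

lemma label_iso_verts: "label_iso f G H \<Longrightarrow> verts H = f ` verts G"
  by (simp add: label_iso_def bij_betw_def)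

lift_definition labels :: "lgraph \<Rightarrow> nat set" is "\<lambda>G. {i. Lab i \<in> verts G}"
proof -
  fix G H assume "isomorphic G H"
  then obtain f where iso: "label_iso f G H" unfolding isomorphic_def by blast
  note f = label_iso_verts[OF iso] label_iso_Lab[OF iso]
  have "Lab i \<in> verts H \<longleftrightarrow> Lab i \<in> verts G" for i
  proof
    assume "Lab i \<in> verts H"
    then obtain v where "v \<in> verts G" "f v = Lab i" unfolding f(1) by auto
    then show "Lab i \<in> verts G" using f(2) by auto
  next
    assume "Lab i \<in> verts G"
    then show "Lab i \<in> verts H" using f(2)[of "Lab i" i] unfolding f(1) by force
  qed
  then show "{i. Lab i \<in> verts G} = {i. Lab i \<in> verts H}" by simp
qed

lift_definition all_labeled :: "lgraph \<Rightarrow> bool" is "\<lambda>G. verts G \<subseteq> range Lab"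
proof -
  fix G H assume "isomorphic G H"
  then obtain f where iso: "label_iso f G H" unfolding isomorphic_def by blast
  note f = label_iso_verts[OF iso] label_iso_Lab[OF iso]
  have eq: "f v \<in> range Lab \<longleftrightarrow> v \<in> range Lab" if "v \<in> verts G" for v
    unfolding image_iff bex_UNIV f(2)[OF that] by (rule refl)
  show "(verts G \<subseteq> range Lab) = (verts H \<subseteq> range Lab)"
    unfolding f(1) image_subset_iff subset_iff using eq by blast
qed

fun forget_vertex :: "vertex \<Rightarrow> vertex" where
  "forget_vertex (Lab i) = Unl (2 * i)"
| "forget_vertex (Unl m) = Unl (2 * m + 1)"

lemma inj_forget_vertex: "inj forget_vertex"
proof (rule injI)
  show "v = w" if "forget_vertex v = forget_vertex w" for v w
    using that by (cases v; cases w; auto; presburger)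
qed

lemma forget_vertex_neq_Lab [simp]: "forget_vertex v \<noteq> Lab i"
  by (cases v) auto

lift_definition unlabel :: "lgraph \<Rightarrow> lgraph" is "map_graph forget_vertex"
proof -
  fix G H assume "isomorphic G H"
  then obtain f where f: "label_iso f G H" and G: "multigraph G"
    unfolding isomorphic_def by blast
  have HG: "H = map_graph f G" using f by (rule label_iso_map_graph)
  let ?G = "map_graph forget_vertex G"
  let ?f = "\<lambda>v. forget_vertex (f (inv forget_vertex v))"
  have mG: "multigraph ?G"
    using G inj_on_subset[OF inj_forget_vertex] by (auto intro: multigraph_map)
  have "isomorphic ?G (map_graph ?f ?G)"
  proof (rule isomorphicI_map[OF mG])
    show "inj_on ?f (verts ?G)"
      using label_iso_inj[OF f]
      by (simp add: inj_on_def map_graph_def inj_eq[OF inj_forget_vertex]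
          inv_f_f[OF inj_forget_vertex])
    show "?f v = Lab i \<longleftrightarrow> v = Lab i" if "v \<in> verts ?G" for v i
      using that by (auto simp: map_graph_def)
  qed
  then show "isomorphic (map_graph forget_vertex G) (map_graph forget_vertex H)"
    by (simp add: HG map_graph_comp inv_f_f[OF inj_forget_vertex])
qed

lift_definition K1 :: lgraph is "({Unl 0}, {#})"
  by (rule isomorphic_refl) (simp add: multigraph_def)

lift_definition K2 :: "nat \<Rightarrow> lgraph" is
  "\<lambda>j. ({Unl 0, Unl 1}, replicate_mset j {Unl 0, Unl 1})"
  by (rule isomorphic_refl) (auto simp: multigraph_def)

definition labeled_graphs :: "nat \<Rightarrow> lgraph set" where
  "labeled_graphs k = {G. labels G = {1..k}}"

lemma labels_abs: "multigraph G \<Longrightarrow> labels (abs_lgraph G) = {i. Lab i \<in> verts G}"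
  by (rule labels.abs_eq) (rule isomorphic_refl)

lemma labels_plus: "labels (a + b) = labels a \<union> labels b"
proof -
  obtain G H where G: "isomorphic G G" and H: "isomorphic H H"
    and eq: "a = abs_lgraph G" "b = abs_lgraph H"
    using ex_rep_lgraph[of a] ex_rep_lgraph[of b] by blast
  note m = isomorphic_reflD[OF G] isomorphic_reflD[OF H]
  have "Lab i \<in> verts (glue G H) \<longleftrightarrow> Lab i \<in> verts G \<or> Lab i \<in> verts H" for i
  proof -
    have "Lab i \<in> left_vertex ` verts G \<longleftrightarrow> Lab i \<in> verts G"
      using imageI[of "Lab i" "verts G" left_vertex] by (auto simp: eq_commute[of "Lab i"])
    moreover have "Lab i \<in> right_vertex ` verts H \<longleftrightarrow> Lab i \<in> verts H"
      using imageI[of "Lab i" "verts H" right_vertex] by (auto simp: eq_commute[of "Lab i"])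
    ultimately show ?thesis by (simp add: glue_def union_graph_def map_graph_def)
  qed
  then show ?thesis
    unfolding plus_lgraph_def eq glue_lgraph.abs_eq[OF G H]
    by (auto simp: labels_abs m multigraph_glue)
qed

lemma unlabel_labeled_graphs_0: "unlabel a \<in> labeled_graphs 0"
proof -
  obtain G where G: "isomorphic G G" and eq: "a = abs_lgraph G"
    using ex_rep_lgraph[of a] by blast
  have "multigraph (map_graph forget_vertex G)"
    using multigraph_map[OF isomorphic_reflD[OF G]] inj_on_subset[OF inj_forget_vertex] by simp
  then have "labels (unlabel a) = {i. Lab i \<in> forget_vertex ` verts G}"
    unfolding eq unlabel.abs_eq[OF G] by (subst labels_abs) (simp_all add: map_graph_def)
  then show ?thesis
    by (simp add: labeled_graphs_def image_iff eq_commute[of "Lab _"])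
qed

lemma unlabel_unlabeled:
  assumes "a \<in> labeled_graphs 0" shows "unlabel a = a"
proof -
  obtain G where G: "isomorphic G G" and eq: "a = abs_lgraph G"
    using ex_rep_lgraph[of a] by blast
  have "Lab i \<notin> verts G" for i
    using assms labels_abs[OF isomorphic_reflD[OF G]] by (auto simp: labeled_graphs_def eq)
  then have "isomorphic G (map_graph forget_vertex G)"
    using inj_on_subset[OF inj_forget_vertex]
    by (intro isomorphicI_map isomorphic_reflD[OF G]) auto
  then have "isomorphic (map_graph forget_vertex G) G" by (rule isomorphic_sym)
  then show ?thesis
    unfolding eq unlabel.abs_eq[OF G] by (rule Quotient3_rel_abs[OF Quotient3_lgraph])
qed

text \<open>
  \<open>\<A> k\<close> is the algebra of \<open>k\<close>-labeled graphs, and \<open>\<A>0 k\<close> is its subalgebra spanned by the graphs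
  all of whose vertices are labeled. A product of elements of \<open>\<A> k\<close> lies in \<open>\<A> k\<close>, but
  for \<open>k > 0\<close> the unit of \<open>\<A> k\<close> is the edgeless graph on the labels, not the
  unit of the type (the empty graph).
\<close>

type_synonym graph_algebra = "lgraph \<Rightarrow>\<^sub>0 real"

definition gr :: "lgraph \<Rightarrow> graph_algebra" where
  "gr G = Poly_Mapping.single G 1"

definition \<A> :: "nat \<Rightarrow> graph_algebra set" where
  "\<A> k = span (gr ` labeled_graphs k)"

definition \<A>0 :: "nat \<Rightarrow> graph_algebra set" where
  "\<A>0 k = span (gr ` {G \<in> labeled_graphs k. all_labeled G})"

text \<open>
  A graph parameter is a function on \<open>labeled_graphs 0\<close>. It is represented by a function on \<open>lgraph\<close>
  whose values outside \<open>labeled_graphs 0\<close> are never used (cf. \<open>unlabel_labeled_graphs_0\<close>).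
\<close>

definition extend :: "(lgraph \<Rightarrow> real) \<Rightarrow> graph_algebra \<Rightarrow> real" where
  "extend t b = (\<Sum>G\<in>Poly_Mapping.keys b. Poly_Mapping.lookup b G * t (unlabel G))"

definition isolate_indifferent :: "(lgraph \<Rightarrow> real) \<Rightarrow> bool" where
  "isolate_indifferent t \<longleftrightarrow> (\<forall>G\<in>labeled_graphs 0. t (G + K1) = t G)"

definition flatly_reflection_positive :: "(lgraph \<Rightarrow> real) \<Rightarrow> bool" where
  "flatly_reflection_positive t \<longleftrightarrow> (\<forall>k. \<forall>b\<in>\<A>0 k. extend t (b\<^sup>2) \<ge> 0)"

definition slowly_growing :: "(lgraph \<Rightarrow> real) \<Rightarrow> bool" where
  "slowly_growing t \<longleftrightarrow> summable (\<lambda>i. 1 / fact i * t (K2 (2 * i)))"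

definition forget_labels :: "graph_algebra \<Rightarrow> graph_algebra" where
  "forget_labels b = (\<Sum>G\<in>Poly_Mapping.keys b. Poly_Mapping.lookup b G *\<^sub>R gr (unlabel G))"

text \<open>Coincidence up to labels and isolated vertices; \<open>G + K1\<close> is the disjoint union.\<close>

definition coincide :: "graph_algebra \<Rightarrow> graph_algebra \<Rightarrow> bool" where
  "coincide x y \<longleftrightarrow>
     forget_labels x - forget_labels y \<in> span {gr (G + K1) - gr G |G. G \<in> labeled_graphs 0}"

definition sums_of_squares :: "graph_algebra set \<Rightarrow> graph_algebra set" where
  "sums_of_squares B = {\<Sum>b\<leftarrow>bs. b\<^sup>2 |bs. set bs \<subseteq> B}"

end

theory Submission
  imports Defs "HOL-Analysis.Convex"
begin

text \<open>
  If \<open>a\<close> plus an arbitrarily small multiple \<open>\<epsilon>\<close> of some partial sum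
  \<open>theta r = (\<Sum>i=0..r. (1 / fact i) *\<^sub>R gr (K2 (2 * i)))\<close> is a sum of squares up to coincidence,
  and \<open>t\<close> is a parameter as in the theorem, then \<open>t\<close> is nonnegative on the sum. As \<open>t\<close> is
  nonnegative on each \<open>K2 (2 * i)\<close>, which is a square, \<open>t\<close> is at most the sum \<open>S\<close> of the
  convergent series on \<open>theta r\<close>. So \<open>0 \<le> extend t a + \<epsilon> * S\<close> for all \<open>\<epsilon> > 0\<close>.

  The converse is a separation argument, without moment problems and without bounds on degrees.
  Adjoin to the graph algebra a formal limit of the partial sums \<open>theta r\<close>, as the second component of
  pairs \<open>(x, c)\<close>, and consider the convex cone of those pairs with \<open>c \<ge> 0\<close> for which
  \<open>x + c *\<^sub>R theta r\<close> is a sum of squares up to coincidence, for some \<open>r\<close> (\<open>theta_cone\<close>). The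
  right-hand side of the theorem amounts to this cone containing all \<open>(a, \<epsilon>)\<close> with \<open>\<epsilon> > 0\<close>. The key
  point is that \<open>(0, 1)\<close> is an order unit for it (\<open>theta_cone_order_unit\<close>): every graph is a
  monomial in the edge variables, and iterated use of \<open>2 * x * y \<le> x\<^sup>2 + y\<^sup>2\<close> bounds a monomial by
  even powers of single variables. All of these become the graphs \<open>K2 (2 * i)\<close> once labels and
  isolated vertices are forgotten, and hence are bounded by multiples of partial sums.

  If \<open>(a, \<epsilon>)\<close> is outside of the cone, the order unit makes the algebraic Hahn--Banach theorem
  applicable (\<open>separation_of_point_from_cone\<close>): some linear \<open>L\<close> that is nonnegative on the cone
  satisfies \<open>L (0, 1) = 1\<close> and \<open>L (a, \<epsilon>) \<le> 0\<close>, and therefore \<open>L (a, 0) \<le> - \<epsilon> < 0\<close>. Restricted to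
  graphs, \<open>L\<close> is a parameter of the required kind (\<open>positive_parameter_from_functional\<close>) that is
  negative at \<open>a\<close>.
\<close>

section \<open>Separating a point from a convex cone\<close>

text \<open>
  The Hahn--Banach separation theorem in the form for cones with an order unit \<open>u\<close>, in a real
  vector space without topology. By Zorn's lemma a cone \<open>D \<supseteq> C\<close> that contains \<open>- p\<close> and is
  maximal among those that omit \<open>- u\<close> exists; maximality makes it a half-space, in the sense that
  it contains \<open>x\<close> or \<open>- x\<close> for each \<open>x\<close>. The functional reads off the position of \<open>x\<close> relative
  to this half-space along the direction \<open>u\<close>.
\<close>

lemma separation_of_point_from_cone:
  fixes C :: "'v::real_vector set" and u p :: 'v
  assumes C: "convex_cone C"
    and u: "u \<in> C"
    and unit: "\<And>x. \<exists>M. x + M *\<^sub>R u \<in> C"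
    and p: "p \<notin> C"
  shows "\<exists>L :: 'v \<Rightarrow> real. linear L \<and> (\<forall>x\<in>C. 0 \<le> L x) \<and> L u = 1 \<and> L p \<le> 0"
proof -
  define extended where "extended D v = {d + c *\<^sub>R v | d c. d \<in> D \<and> 0 \<le> c}" for D and v :: 'v
  have cone_extended: "convex_cone (extended D v)" if D: "convex_cone D" for D v
    unfolding convex_cone_iff
  proof (intro conjI ballI allI impI)
    have "0 = 0 + 0 *\<^sub>R v" by simp
    then show "0 \<in> extended D v"
      using D unfolding extended_def convex_cone_iff by blast
  next
    fix x y assume "x \<in> extended D v" "y \<in> extended D v"
    then obtain d c d' c' where "x = d + c *\<^sub>R v" "y = d' + c' *\<^sub>R v" "d \<in> D" "d' \<in> D" "0 \<le> c" "0 \<le> c'"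
      unfolding extended_def by blast
    then have "x + y = (d + d') + (c + c') *\<^sub>R v" "d + d' \<in> D" "0 \<le> c + c'"
      using D by (auto simp: convex_cone_iff algebra_simps)
    then show "x + y \<in> extended D v" unfolding extended_def by blast
  next
    fix x and e :: real assume "x \<in> extended D v" and e: "0 \<le> e"
    then obtain d c where "x = d + c *\<^sub>R v" "d \<in> D" "0 \<le> c"
      unfolding extended_def by blast
    then have "e *\<^sub>R x = e *\<^sub>R d + (e * c) *\<^sub>R v" "e *\<^sub>R d \<in> D" "0 \<le> e * c"
      using D e by (auto simp: convex_cone_iff algebra_simps)
    then show "e *\<^sub>R x \<in> extended D v" unfolding extended_def by blast
  qed
  have extended: "D \<subseteq> extended D v" "convex_cone D \<Longrightarrow> v \<in> extended D v" for D v
  proof -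
    have "d = d + 0 *\<^sub>R v" for d :: 'v by simp
    then show "D \<subseteq> extended D v" unfolding extended_def by blast
    have "v = 0 + 1 *\<^sub>R v" by simp
    then show "convex_cone D \<Longrightarrow> v \<in> extended D v" unfolding extended_def convex_cone_iff
      using zero_le_one by blast
  qed
  \<comment> \<open>If adjoining \<open>v\<close> to a cone that contains \<open>u\<close> but not \<open>- u\<close> brings in \<open>- u\<close>, then
    this cone already contains \<open>- v\<close>.\<close>
  have opposite: "- v \<in> D"
    if D: "convex_cone D" and uD: "u \<in> D" "- u \<notin> D" and ext: "- u \<in> extended D v" for D v
  proof -
    obtain d c where dc: "- u = d + c *\<^sub>R v" "d \<in> D" "0 \<le> c"
      using ext unfolding extended_def by blast
    have "c \<noteq> 0" using dc uD by auto
    have "u = - (d + c *\<^sub>R v)" using dc(1) by (simp only: minus_minus flip: dc(1))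
    then have "- v = (1 / c) *\<^sub>R (u + d)" using \<open>c \<noteq> 0\<close> by simp
    moreover have "u + d \<in> D" using D uD dc(2) unfolding convex_cone_iff by blast
    moreover have "0 \<le> 1 / c" using dc(3) by simp
    ultimately show ?thesis using D unfolding convex_cone_iff by metis
  qed
  have minus_u: "- u \<notin> C"
  proof
    assume minus: "- u \<in> C"
    obtain M where M: "p + M *\<^sub>R u \<in> C" using unit by blast
    have "(p + M *\<^sub>R u) + (\<bar>M\<bar> *\<^sub>R (- u) + (\<bar>M\<bar> - M) *\<^sub>R u) \<in> C"
      by (intro convex_cone_add[OF C] convex_cone_scaleR[OF C] M minus u) auto
    then show False using p by (simp add: algebra_simps)
  qed
  obtain D where D: "convex_cone D" "C \<subseteq> D" "- p \<in> D" "- u \<notin> D"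
    and max: "\<And>E. convex_cone E \<Longrightarrow> D \<subseteq> E \<Longrightarrow> - u \<notin> E \<Longrightarrow> E = D"
  proof -
    define S where "S = {D. convex_cone D \<and> C \<subseteq> D \<and> - p \<in> D \<and> - u \<notin> D}"
    have "- u \<notin> extended C (- p)"
      using opposite[OF C u minus_u, of "- p"] p by auto
    then have "extended C (- p) \<in> S"
      using C cone_extended extended[of C "- p"] by (auto simp: S_def)
    then have "S \<noteq> {}" by blast
    then have "\<exists>D\<in>S. \<forall>E\<in>S. D \<subseteq> E \<longrightarrow> E = D"
    proof (rule subset_Zorn_nonempty)
      fix \<D> assume ne: "\<D> \<noteq> {}" and chain: "subset.chain S \<D>"
      have sub: "\<D> \<subseteq> S" and lin: "\<And>X Y. X \<in> \<D> \<Longrightarrow> Y \<in> \<D> \<Longrightarrow> X \<subseteq> Y \<or> Y \<subseteq> X"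
        using chain unfolding subset.chain_def by auto
      have "x + y \<in> \<Union>\<D>" if xy: "x \<in> \<Union>\<D>" "y \<in> \<Union>\<D>" for x y
      proof -
        obtain X Y where "X \<in> \<D>" "Y \<in> \<D>" "x \<in> X" "y \<in> Y" using xy by blast
        moreover from this obtain Z where "Z \<in> \<D>" "x \<in> Z" "y \<in> Z" using lin by blast
        ultimately show ?thesis using sub unfolding S_def convex_cone_iff by blast
      qed
      moreover have "c *\<^sub>R x \<in> \<Union>\<D>" if "x \<in> \<Union>\<D>" "0 \<le> c" for x c
        using that sub unfolding S_def convex_cone_iff by blast
      moreover have "0 \<in> \<Union>\<D>" using ne sub unfolding S_def convex_cone_iff by blast
      ultimately have "convex_cone (\<Union>\<D>)" by (simp only: convex_cone_iff) blast
      then show "\<Union>\<D> \<in> S" using ne sub unfolding S_def by blast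
    qed
    then obtain D where DS: "D \<in> S" and max: "\<And>E. E \<in> S \<Longrightarrow> D \<subseteq> E \<Longrightarrow> E = D" by blast
    show ?thesis
    proof (rule that)
      show "convex_cone D" "C \<subseteq> D" "- p \<in> D" "- u \<notin> D" using DS by (simp_all add: S_def)
      fix E assume "convex_cone E" "D \<subseteq> E" "- u \<notin> E"
      then show "E = D" using DS by (intro max) (auto simp: S_def)
    qed
  qed
  have Dadd: "x + y \<in> D" if "x \<in> D" "y \<in> D" for x y using D(1) that by (auto simp: convex_cone_iff)
  have Dscale: "c *\<^sub>R x \<in> D" if "x \<in> D" "0 \<le> c" for x c using D(1) that by (auto simp: convex_cone_iff)
  have uD: "u \<in> D" using u D(2) by blast
  have total: "x \<in> D \<or> - x \<in> D" for x
  proof (cases "- u \<in> extended D x")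
    case True
    then show ?thesis using opposite[OF D(1) uD D(4)] by blast
  next
    case False
    then have "extended D x = D" using max cone_extended D(1) extended(1) by blast
    then show ?thesis using extended(2)[OF D(1)] by blast
  qed
  have unit_multiple: "0 \<le> c" if "c *\<^sub>R u \<in> D" for c
  proof (rule ccontr)
    assume "\<not> 0 \<le> c"
    then show False using Dscale[OF that, of "- 1 / c"] D(4) by (simp add: divide_nonpos_neg)
  qed
  \<comment> \<open>The set below is a half-line unbounded to the left: it is nonempty because \<open>u\<close> is an order
    unit, and bounded above because \<open>D\<close> omits \<open>- u\<close>.\<close>
  define L where "L x = Sup {c. x - c *\<^sub>R u \<in> D}" for x
  have L_bdd: "bdd_above {c. x - c *\<^sub>R u \<in> D}" for x
  proof -
    obtain M where M: "- x + M *\<^sub>R u \<in> D" using unit D(2) by blast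
    have "c \<le> M" if "x - c *\<^sub>R u \<in> D" for c
    proof -
      have "(x - c *\<^sub>R u) + (- x + M *\<^sub>R u) = (M - c) *\<^sub>R u" by (simp add: algebra_simps)
      then show ?thesis using Dadd[OF that M] unit_multiple[of "M - c"] by simp
    qed
    then show ?thesis by (intro bdd_aboveI) auto
  qed
  have L_ne: "{c. x - c *\<^sub>R u \<in> D} \<noteq> {}" for x
  proof -
    obtain M where "x + M *\<^sub>R u \<in> D" using unit D(2) by blast
    then have "x - (- M) *\<^sub>R u \<in> D" by simp
    then show ?thesis by blast
  qed
  have L_ge: "c \<le> L x" if "x - c *\<^sub>R u \<in> D" for x c
    unfolding L_def using that L_bdd by (intro cSup_upper) auto
  have below_L: "x - c *\<^sub>R u \<in> D" if less: "c < L x" for x c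
  proof -
    obtain e where e: "x - e *\<^sub>R u \<in> D" "c < e"
      using less unfolding L_def less_cSup_iff[OF L_ne L_bdd] by blast
    have "(x - e *\<^sub>R u) + (e - c) *\<^sub>R u \<in> D" using e uD by (intro Dadd Dscale) auto
    then show ?thesis by (simp add: algebra_simps)
  qed
  have L_le: "L x \<le> c" if "c *\<^sub>R u - x \<in> D" for x c
  proof (rule ccontr)
    assume "\<not> L x \<le> c"
    then obtain e where "c < e" "e < L x" using dense[of c "L x"] by (auto simp: not_le)
    then have "(x - e *\<^sub>R u) + (c *\<^sub>R u - x) \<in> D" using that by (intro Dadd below_L)
    then have "(c - e) *\<^sub>R u \<in> D" by (simp add: algebra_simps)
    then show False using unit_multiple[of "c - e"] \<open>c < e\<close> by simp
  qed
  have above_L: "c *\<^sub>R u - x \<in> D" if "L x < c" for x c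
    using total[of "x - c *\<^sub>R u"] L_ge[of x c] that by auto
  \<comment> \<open>As \<open>D\<close> need not be closed, the supremum need not be attained, and \<open>L x\<close> is
    pinned down by approximations from both sides.\<close>
  have L_eqI: "L x = c" if "\<And>e. e > 0 \<Longrightarrow> x - (c - e) *\<^sub>R u \<in> D" "\<And>e. e > 0 \<Longrightarrow> (c + e) *\<^sub>R u - x \<in> D" for x c
  proof (rule antisym)
    show "L x \<le> c" using L_le[OF that(2)] by (rule field_le_epsilon)
    show "c \<le> L x" using L_ge[OF that(1)] unfolding diff_le_eq by (rule field_le_epsilon)
  qed
  have L_add: "L (x + y) = L x + L y" for x y
  proof (rule L_eqI)
    fix e :: real assume e: "e > 0"
    have "(L x - e / 2) *\<^sub>R u + (L y - e / 2) *\<^sub>R u = (L x + L y - e) *\<^sub>R u"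
      by (simp flip: scaleR_add_left)
    moreover have "(x - (L x - e / 2) *\<^sub>R u) + (y - (L y - e / 2) *\<^sub>R u) \<in> D"
      using e by (intro Dadd below_L) auto
    ultimately show "x + y - (L x + L y - e) *\<^sub>R u \<in> D" by (simp only: add_diff_add[symmetric])
    have "(L x + e / 2) *\<^sub>R u + (L y + e / 2) *\<^sub>R u = (L x + L y + e) *\<^sub>R u"
      by (simp flip: scaleR_add_left)
    moreover have "((L x + e / 2) *\<^sub>R u - x) + ((L y + e / 2) *\<^sub>R u - y) \<in> D"
      using e by (intro Dadd above_L) auto
    ultimately show "(L x + L y + e) *\<^sub>R u - (x + y) \<in> D" by (simp only: add_diff_add[symmetric])
  qed
  have L_zero: "L 0 = 0" using L_add[of 0 0] by simp
  have L_minus: "L (- x) = - L x" for x using L_add[of x "- x"] L_zero by simp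
  have L_pos: "L (c *\<^sub>R x) = c * L x" if c: "c > 0" for c x
  proof (rule L_eqI)
    fix e :: real assume e: "e > 0"
    have "c *\<^sub>R (x - (L x - e / c) *\<^sub>R u) \<in> D"
      using e c by (intro Dscale below_L) auto
    then show "c *\<^sub>R x - (c * L x - e) *\<^sub>R u \<in> D" using c by (simp add: algebra_simps)
    have "c *\<^sub>R ((L x + e / c) *\<^sub>R u - x) \<in> D"
      using e c by (intro Dscale above_L) auto
    then show "(c * L x + e) *\<^sub>R u - c *\<^sub>R x \<in> D" using c by (simp add: algebra_simps)
  qed
  have L_scale: "L (c *\<^sub>R x) = c * L x" for c x
    using L_pos[of c x] L_pos[of "- c" x] L_zero L_minus[of "c *\<^sub>R x"]
    by (cases c "0::real" rule: linorder_cases) auto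
  show ?thesis
  proof (intro exI[of _ L] conjI ballI)
    show "linear L" by (rule linearI) (simp_all add: L_add L_scale)
    show "0 \<le> L x" if "x \<in> C" for x using that D(2) by (intro L_ge) auto
    show "L u = 1"
    proof (rule antisym)
      show "L u \<le> 1" using D(1) by (intro L_le) (simp add: convex_cone_iff)
      show "1 \<le> L u" using D(1) by (intro L_ge) (simp add: convex_cone_iff)
    qed
    have "0 \<le> L (- p)" using D(3) by (intro L_ge) auto
    then show "L p \<le> 0" by (simp add: L_minus)
  qed
qed

section \<open>Graphs up to isomorphism, and monomials\<close>

lemma abs_lgraph_eqI: "isomorphic G H \<Longrightarrow> abs_lgraph G = abs_lgraph H"
  by (rule Quotient3_rel_abs[OF Quotient3_lgraph])

lemma lgraph_cases: obtains G where "multigraph G" "a = abs_lgraph G"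
  using ex_rep_lgraph[of a] isomorphic_reflD by blast

text \<open>
  Sums are computed along any two embeddings that overlap in labels only; for two graphs without
  unlabeled vertices both can be the identity.
\<close>

lemma plus_abs_lgraph:
  assumes G: "multigraph G" and H: "multigraph H"
    and p: "inj_on p (verts G)" "\<And>v i. v \<in> verts G \<Longrightarrow> p v = Lab i \<longleftrightarrow> v = Lab i"
    and q: "inj_on q (verts H)" "\<And>v i. v \<in> verts H \<Longrightarrow> q v = Lab i \<longleftrightarrow> v = Lab i"
    and pq: "\<And>v w. v \<in> verts G \<Longrightarrow> w \<in> verts H \<Longrightarrow> p v = q w \<Longrightarrow> \<exists>i. v = Lab i \<and> w = Lab i"
  shows "abs_lgraph G + abs_lgraph H = abs_lgraph (union_graph (map_graph p G) (map_graph q H))"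
  unfolding plus_lgraph_def glue_lgraph.abs_eq[OF isomorphic_refl[OF G] isomorphic_refl[OF H]]
  by (rule abs_lgraph_eqI[OF isomorphic_union_maps[OF assms]])

lemma unlabel_abs: "multigraph G \<Longrightarrow> unlabel (abs_lgraph G) = abs_lgraph (map_graph forget_vertex G)"
  by (rule unlabel.abs_eq[OF isomorphic_refl])

lemma multigraph_forget: "multigraph G \<Longrightarrow> multigraph (map_graph forget_vertex G)"
  using inj_on_subset[OF inj_forget_vertex] by (auto intro: multigraph_map)

text \<open>
  Forgetting labels forgets all names of vertices, so any injective renaming is absorbed, even one
  that turns unlabeled vertices into labeled ones.
\<close>

lemma unlabel_map_graph:
  assumes G: "multigraph G" and f: "inj_on f (verts G)"
  shows "unlabel (abs_lgraph (map_graph f G)) = unlabel (abs_lgraph G)"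
proof -
  let ?g = "\<lambda>v. forget_vertex (f (inv forget_vertex v))"
  have "isomorphic (map_graph forget_vertex G) (map_graph ?g (map_graph forget_vertex G))"
    using f by (intro isomorphicI_map multigraph_forget[OF G])
      (auto simp: inj_on_def map_graph_def inj_eq[OF inj_forget_vertex] inv_f_f[OF inj_forget_vertex])
  also have "map_graph ?g (map_graph forget_vertex G) = map_graph forget_vertex (map_graph f G)"
    by (simp add: map_graph_comp inv_f_f[OF inj_forget_vertex])
  finally show ?thesis
    unfolding unlabel_abs[OF G] unlabel_abs[OF multigraph_map[OF G f]]
    by (rule abs_lgraph_eqI[symmetric])
qed

lemma unlabel_unlabel [simp]: "unlabel (unlabel G) = unlabel G"
  by (rule unlabel_unlabeled[OF unlabel_labeled_graphs_0])

lemma all_labeled_abs: "multigraph G \<Longrightarrow> all_labeled (abs_lgraph G) \<longleftrightarrow> verts G \<subseteq> range Lab"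
  by (rule all_labeled.abs_eq[OF isomorphic_refl])

lemma all_labeled_plus:
  assumes "all_labeled a" "all_labeled b" shows "all_labeled (a + b)"
proof -
  obtain G H where G: "multigraph G" "a = abs_lgraph G" and H: "multigraph H" "b = abs_lgraph H"
    by (metis lgraph_cases)
  have GH: "verts G \<subseteq> range Lab" "verts H \<subseteq> range Lab"
    using assms by (simp_all add: G H all_labeled_abs)
  have "a + b = abs_lgraph (union_graph (map_graph id G) (map_graph id H))"
    unfolding G H using GH by (intro plus_abs_lgraph G H) auto
  also have "union_graph (map_graph id G) (map_graph id H) = union_graph G H"
    using G H by (simp add: map_graph_ident)
  finally show ?thesis using GH G H by (auto simp: all_labeled_abs multigraph_union) (auto simp: union_graph_def)
qed

definition valid_edges :: "nat set \<Rightarrow> nat set multiset \<Rightarrow> bool" where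
  "valid_edges V M \<longleftrightarrow> finite V \<and> (\<forall>e\<in>#M. e \<subseteq> V \<and> card e = 2)"

text \<open>
  With \<open>\<A>0 k\<close> seen as a polynomial algebra, \<open>flat {1..k} M\<close> is the monomial
  \<open>\<Prod>ij\<in>#M. z\<^sub>i\<^sub>j\<close>, and \<open>flat {1..k} {#}\<close> is the unit.
\<close>

definition flat :: "nat set \<Rightarrow> nat set multiset \<Rightarrow> lgraph" where
  "flat V M = abs_lgraph (Lab ` V, image_mset ((`) Lab) M)"

lemma inj_Lab: "inj_on Lab A" by (auto intro: inj_onI)

lemma multigraph_flat: "valid_edges V M \<Longrightarrow> multigraph (Lab ` V, image_mset ((`) Lab) M)"
  by (auto simp: multigraph_def valid_edges_def card_image[OF inj_Lab])

lemma valid_edges_simps [simp]: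
  "valid_edges V {#} \<longleftrightarrow> finite V"
  "valid_edges V (add_mset e M) \<longleftrightarrow> valid_edges V M \<and> e \<subseteq> V \<and> card e = 2"
  "valid_edges V (M + N) \<longleftrightarrow> valid_edges V M \<and> valid_edges V N"
  by (auto simp: valid_edges_def)

lemma valid_edges_mono: "valid_edges V M \<Longrightarrow> V \<subseteq> W \<Longrightarrow> finite W \<Longrightarrow> valid_edges W M"
  by (auto simp: valid_edges_def)

lemma valid_edges_repeat: "valid_edges V M \<Longrightarrow> valid_edges V (repeat_mset n M)"
  by (induction n) (auto simp: valid_edges_def)

lemma flat_plus:
  assumes "valid_edges V M" "valid_edges W N"
  shows "flat V M + flat W N = flat (V \<union> W) (M + N)"
proof -
  note m = assms[THEN multigraph_flat]
  have "flat V M + flat W N = abs_lgraph (union_graph (map_graph id (Lab ` V, image_mset ((`) Lab) M))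
      (map_graph id (Lab ` W, image_mset ((`) Lab) N)))"
    unfolding flat_def by (intro plus_abs_lgraph m) auto
  then show ?thesis using m by (simp add: flat_def map_graph_ident union_graph_def image_Un)
qed

lemma labels_flat: "valid_edges V M \<Longrightarrow> labels (flat V M) = V"
  by (auto simp: flat_def labels_abs multigraph_flat)

lemma all_labeled_flat: "valid_edges V M \<Longrightarrow> all_labeled (flat V M)"
  by (auto simp: flat_def all_labeled_abs multigraph_flat)

text \<open>Numbering all vertices turns any graph into a monomial.\<close>

lemma ex_flat_unlabel:
  obtains k M where "valid_edges {1..k} M" "unlabel (flat {1..k} M) = unlabel a"
proof -
  obtain G where G: "multigraph G" "a = abs_lgraph G" by (rule lgraph_cases)
  then have fin: "finite (verts G)" by (simp add: multigraph_def)
  obtain h where h: "bij_betw h (verts G) {1..card (verts G)}"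
    using ex_bij_betw_finite_nat[OF fin] bij_betw_same_card[of _ "verts G"]
    by (metis fin finite_same_card_bij card_atLeastAtMost finite_atLeastAtMost diff_Suc_1 One_nat_def)
  define M where "M = image_mset ((`) h) (edges G)"
  have inj: "inj_on h (verts G)" and im: "h ` verts G = {1..card (verts G)}"
    using h by (auto simp: bij_betw_def)
  have "valid_edges {1..card (verts G)} M"
    unfolding valid_edges_def M_def
  proof (intro conjI ballI)
    fix e assume "e \<in># image_mset ((`) h) (edges G)"
    then obtain d where d: "e = h ` d" "d \<in># edges G" by auto
    then have "d \<subseteq> verts G" "card d = 2" using G by (auto simp: multigraph_def)
    then show "e \<subseteq> {1..card (verts G)}" "card e = 2"
      using d im card_image[OF inj_on_subset[OF inj]] by auto
  qed simp
  moreover have "map_graph (\<lambda>v. Lab (h v)) G = (Lab ` {1..card (verts G)}, image_mset ((`) Lab) M)"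
    unfolding im[symmetric] by (simp add: map_graph_def M_def image_image multiset.map_comp comp_def)
  then have "unlabel (flat {1..card (verts G)} M) = unlabel a"
    unfolding flat_def G(2)
    using unlabel_map_graph[OF G(1), of "\<lambda>v. Lab (h v)"] inj by (simp add: inj_on_def)
  ultimately show ?thesis by (rule that)
qed

lemma unlabel_edge:
  assumes "card e = 2"
  shows "unlabel (flat e (replicate_mset n e)) = K2 n"
proof -
  obtain i j where e: "e = {i, j}" "i \<noteq> j" using assms by (auto simp: card_2_iff)
  define f where "f v = (if v = Unl 0 then Lab i else Lab j)" for v
  let ?K = "({Unl 0, Unl 1}, replicate_mset n {Unl 0, Unl 1})"
  have mg: "multigraph ?K" by (auto simp: multigraph_def)
  have "K2 n = abs_lgraph ?K" by (simp add: K2_def)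
  moreover have "flat e (replicate_mset n e) = abs_lgraph (map_graph f ?K)"
    by (simp add: flat_def map_graph_def f_def e insert_commute)
  moreover have "unlabel (K2 n) = K2 n"
    unfolding \<open>K2 n = abs_lgraph ?K\<close>
    using labels_abs[OF mg] by (intro unlabel_unlabeled) (simp add: labeled_graphs_def)
  ultimately show ?thesis
    using unlabel_map_graph[OF mg, of f] e by (simp add: f_def inj_on_def)
qed

lemma plus_isolated_label:
  assumes "multigraph G"
  shows "abs_lgraph G + flat {i} {#} = abs_lgraph (insert (Lab i) (verts G), edges G)"
proof -
  have "multigraph ({Lab i}, {#})" by (simp add: multigraph_def)
  then have "abs_lgraph G + flat {i} {#} =
    abs_lgraph (union_graph (map_graph id G) (map_graph id ({Lab i}, {#})))"
    using assms plus_abs_lgraph[of G "({Lab i}, {#})" id id] by (simp add: flat_def)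
  then show ?thesis using assms by (simp add: map_graph_ident) (simp add: union_graph_def map_graph_def)
qed

lemma unlabel_plus_isolated_label:
  assumes "i \<notin> labels a"
  shows "unlabel (a + flat {i} {#}) = unlabel a + K1"
proof -
  obtain G where G: "multigraph G" and a: "a = abs_lgraph G" by (rule lgraph_cases)
  have i: "Lab i \<notin> verts G" using assms by (simp add: a labels_abs[OF G])
  have mg: "multigraph (insert (Lab i) (verts G), edges G)" "multigraph ({Unl 0}, {#})"
    using G by (auto simp: multigraph_def)
  have new: "forget_vertex (Lab i) \<notin> forget_vertex ` verts G"
    using i by (simp only: inj_image_mem_iff[OF inj_forget_vertex] not_False_eq_True)
  have "unlabel a + K1 = abs_lgraph (union_graph (map_graph id (map_graph forget_vertex G))
      (map_graph (\<lambda>_. forget_vertex (Lab i)) ({Unl 0}, {#})))"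
    unfolding a unlabel_abs[OF G] K1_def using new
    by (intro plus_abs_lgraph multigraph_forget G mg) (auto simp: map_graph_def)
  also have "\<dots> = abs_lgraph (map_graph forget_vertex (insert (Lab i) (verts G), edges G))"
    by (simp add: map_graph_def union_graph_def)
  also have "\<dots> = unlabel (a + flat {i} {#})"
    unfolding a plus_isolated_label[OF G] unlabel_abs[OF mg(1)] ..
  finally show ?thesis ..
qed

lemma plus_isolated_label_absorb:
  assumes "i \<in> labels a"
  shows "a + flat {i} {#} = a"
proof -
  obtain G where G: "multigraph G" and a: "a = abs_lgraph G" by (rule lgraph_cases)
  then show ?thesis using assms
    by (simp add: plus_isolated_label[OF G] labels_abs[OF G] insert_absorb)
qed

section \<open>Linear maps on the graph algebra\<close>

lemma lookup_scaleR: "Poly_Mapping.lookup (c *\<^sub>R (x :: 'a \<Rightarrow>\<^sub>0 real)) k = c * Poly_Mapping.lookup x k"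
proof -
  have "finite {k. c * Poly_Mapping.lookup x k \<noteq> 0}"
    by (rule finite_subset[OF _ finite_keys[of x]]) (auto simp: in_keys_iff)
  then show ?thesis by (simp add: scaleR_poly_mapping_def)
qed

lemma scaleR_conv_mult: "c *\<^sub>R x = Poly_Mapping.single 0 c * (x :: graph_algebra)"
  unfolding mult_map_scale_conv_mult[symmetric]
  by (rule poly_mapping_eqI) (simp add: lookup_scaleR map.rep_eq when_def)

lemma scaleR_mult_left: "(c *\<^sub>R x) * y = c *\<^sub>R (x * y :: graph_algebra)"
  by (simp add: scaleR_conv_mult mult.assoc)

lemma gr_mult: "gr G * gr H = gr (G + H)"
  by (simp add: gr_def mult_single)

lemma linear_mult_right: "linear (\<lambda>x. x * y :: graph_algebra)"
  by (rule linearI) (simp_all add: scaleR_mult_left distrib_right)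

lemma linear_sum_keys:
  fixes f :: "'a \<Rightarrow> 'v::real_vector"
  shows "linear (\<lambda>b. \<Sum>G\<in>Poly_Mapping.keys b. Poly_Mapping.lookup b G *\<^sub>R f G)" (is "linear ?T")
proof -
  have T: "?T b = (\<Sum>G\<in>A. Poly_Mapping.lookup b G *\<^sub>R f G)"
    if "finite A" "Poly_Mapping.keys b \<subseteq> A" for A b
    using that by (intro sum.mono_neutral_left) (auto simp: in_keys_iff)
  show ?thesis
  proof (rule linearI)
    fix x y :: "'a \<Rightarrow>\<^sub>0 real" and c :: real
    let ?A = "Poly_Mapping.keys x \<union> Poly_Mapping.keys y"
    have "?T (x + y) = (\<Sum>G\<in>?A. Poly_Mapping.lookup (x + y) G *\<^sub>R f G)"
      by (rule T) (use keys_add[of x y] in auto)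
    also have "\<dots> = ?T x + ?T y"
      by (simp add: T[of ?A x] T[of ?A y] lookup_add scaleR_add_left sum.distrib)
    finally show "?T (x + y) = ?T x + ?T y" .
    have "?T (c *\<^sub>R x) = (\<Sum>G\<in>Poly_Mapping.keys x. Poly_Mapping.lookup (c *\<^sub>R x) G *\<^sub>R f G)"
      by (rule T) (auto simp: in_keys_iff lookup_scaleR)
    then show "?T (c *\<^sub>R x) = c *\<^sub>R ?T x"
      by (simp add: lookup_scaleR scaleR_sum_right)
  qed
qed

lemma span_gr: "x \<in> span (range gr)"
proof -
  have "x = (\<Sum>G\<in>Poly_Mapping.keys x. Poly_Mapping.lookup x G *\<^sub>R gr G)"
    by (rule poly_mapping_eqI)
      (simp add: lookup_sum lookup_scaleR gr_def lookup_single when_def in_keys_iff if_distrib cong: if_cong)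
  also have "\<dots> \<in> span (range gr)"
    by (intro span_sum span_scale span_base) auto
  finally show ?thesis .
qed

lemma linear_eq_gr:
  assumes "linear f" "linear g" "\<And>G. f (gr G) = g (gr G)"
  shows "f x = g x"
  by (rule linear_eq_on[OF assms(1,2) span_gr]) (use assms(3) in auto)

lemma linear_forget_labels: "linear forget_labels"
  using linear_sum_keys[of "\<lambda>G. gr (unlabel G)"] by (simp add: forget_labels_def[abs_def])

lemma linear_extend: "linear (extend t)"
  using linear_sum_keys[of "\<lambda>G. t (unlabel G)"] by (simp add: extend_def[abs_def])

lemma forget_labels_gr [simp]: "forget_labels (gr G) = gr (unlabel G)"
  by (simp add: forget_labels_def gr_def)

lemma extend_gr: "extend t (gr G) = t (unlabel G)"
  by (simp add: extend_def gr_def)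

section \<open>Coincidence up to labels and isolated vertices\<close>

definition isolate_relations :: "graph_algebra set" where
  "isolate_relations = span {gr (G + K1) - gr G |G. G \<in> labeled_graphs 0}"

lemma subspace_isolate_relations: "subspace isolate_relations"
  unfolding isolate_relations_def by (rule subspace_span)

lemma coincide_iff: "coincide x y \<longleftrightarrow> forget_labels (x - y) \<in> isolate_relations"
  by (simp add: coincide_def isolate_relations_def linear_diff[OF linear_forget_labels])

lemma coincideI_forget: "forget_labels x = forget_labels y \<Longrightarrow> coincide x y"
  by (simp add: coincide_def span_zero)

lemma coincide_refl: "coincide x x"
  by (rule coincideI_forget) (rule refl)

lemma coincide_trans [trans]: "coincide x y \<Longrightarrow> coincide y z \<Longrightarrow> coincide x z"
  unfolding coincide_def by (drule (1) span_add) simp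

lemma coincide_sym: "coincide x y \<Longrightarrow> coincide y x"
  unfolding coincide_def by (drule span_neg) simp

lemma coincide_add: "coincide x y \<Longrightarrow> coincide x' y' \<Longrightarrow> coincide (x + x') (y + y')"
  unfolding coincide_def linear_add[OF linear_forget_labels]
  by (drule (1) span_add) (simp add: algebra_simps)

lemma coincide_scaleR: "coincide x y \<Longrightarrow> coincide (c *\<^sub>R x) (c *\<^sub>R y)"
  unfolding coincide_def linear_scale[OF linear_forget_labels]
  by (drule span_scale[of _ _ c]) (simp add: algebra_simps)

lemma coincide_minus: "coincide x y \<Longrightarrow> coincide (- x) (- y)"
  using coincide_scaleR[of x y "-1"] by simp

lemma coincide_unlabel: "unlabel G = unlabel H \<Longrightarrow> coincide (gr G) (gr H)"
  by (rule coincideI_forget) simp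

lemma extend_coincide:
  assumes t: "isolate_indifferent t" and "coincide x y"
  shows "extend t x = extend t y"
proof -
  have "extend t z = 0" if "z \<in> isolate_relations" for z
  proof -
    have "extend t z = (\<lambda>_. 0) z"
    proof (rule linear_eq_on[OF linear_extend])
      show "linear (\<lambda>_::graph_algebra. 0 :: real)" by (rule linear_zero)
      show "z \<in> span {gr (G + K1) - gr G |G. G \<in> labeled_graphs 0}"
        using that by (simp add: isolate_relations_def)
      fix x assume "x \<in> {gr (G + K1) - gr G |G. G \<in> labeled_graphs 0}"
      then obtain G where x: "x = gr (G + K1) - gr G" and G: "G \<in> labeled_graphs 0" by blast
      have "K1 \<in> labeled_graphs 0"
        by (simp add: labeled_graphs_def K1_def labels_abs multigraph_def)
      then have "G + K1 \<in> labeled_graphs 0"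
        using G by (simp add: labeled_graphs_def labels_plus)
      then show "extend t x = 0"
        using t G by (simp add: x linear_diff[OF linear_extend] extend_gr unlabel_unlabeled
            isolate_indifferent_def)
    qed
    then show ?thesis by simp
  qed
  moreover have "extend t (forget_labels z) = extend t z" for z
    using linear_eq_gr[OF linear_compose[OF linear_forget_labels linear_extend] linear_extend]
    by (simp add: extend_gr)
  ultimately have "extend t (x - y) = 0" using \<open>coincide x y\<close> unfolding coincide_iff by metis
  then show ?thesis by (simp add: linear_diff[OF linear_extend])
qed

text \<open>
  A new isolated labeled vertex is an isolated vertex, and an old one is absorbed. Multiplication
  by an edgeless graph therefore does not change an element up to coincidence; this is how the
  squares of different algebras \<open>\<A>0 k\<close> are brought into a common one.
\<close>

lemma coincide_isolated_label: "coincide (gr (G + flat {i} {#})) (gr G)"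
proof (cases "i \<in> labels G")
  case True
  then show ?thesis by (simp add: plus_isolated_label_absorb coincide_refl)
next
  case False
  have "gr (unlabel G + K1) - gr (unlabel G) \<in> isolate_relations"
    unfolding isolate_relations_def using unlabel_labeled_graphs_0 by (intro span_base) blast
  then show ?thesis
    using False by (simp add: coincide_iff linear_diff[OF linear_forget_labels]
        unlabel_plus_isolated_label)
qed

definition edgeless :: "nat \<Rightarrow> graph_algebra" where
  "edgeless k = gr (flat {1..k} {#})"

lemma coincide_edgeless_gr: "coincide (gr (G + flat {1..k} {#})) (gr G)"
proof (induction k)
  case 0
  have "flat {} {#} = 0" by (simp add: flat_def zero_lgraph_def empty_lgraph_def)
  then show ?case by (simp add: coincide_refl)
next
  case (Suc k)
  have "flat {1..Suc k} {#} = flat {1..k} {#} + flat {Suc k} {#}"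
    by (simp add: flat_plus atLeastAtMostSuc_conv)
  then have "coincide (gr (G + flat {1..Suc k} {#})) (gr (G + flat {1..k} {#}))"
    using coincide_isolated_label[of "G + flat {1..k} {#}" "Suc k"] by (simp add: add.assoc)
  then show ?case using Suc.IH by (rule coincide_trans)
qed

lemma coincide_edgeless: "coincide (x * edgeless k) x"
proof -
  have "forget_labels (x * edgeless k - x) \<in> isolate_relations"
  proof (rule span_induct[OF span_gr[of x]])
    have "linear (\<lambda>x. forget_labels (x * edgeless k - x))"
      using linear_compose[OF linear_compose_sub[OF linear_mult_right linear_id] linear_forget_labels]
      by (simp add: comp_def)
    then show "subspace {x. forget_labels (x * edgeless k - x) \<in> isolate_relations}"
      using linear_subspace_vimage[OF _ subspace_isolate_relations] by (simp add: vimage_def)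
    show "forget_labels (y * edgeless k - y) \<in> isolate_relations" if "y \<in> range gr" for y
      using that coincide_edgeless_gr by (auto simp: edgeless_def gr_mult coincide_iff)
  qed
  then show ?thesis by (simp add: coincide_iff)
qed

lemma edgeless_mult: "k \<le> l \<Longrightarrow> edgeless k * edgeless l = edgeless l"
  by (simp add: edgeless_def gr_mult flat_plus) (metis sup.absorb2 atLeastatMost_subset_iff order_refl)

section \<open>Sums of squares up to coincidence\<close>

lemma subspace_A0: "subspace (\<A>0 k)"
  unfolding \<A>0_def by (rule subspace_span)

lemma flat_in_A0: "valid_edges {1..k} M \<Longrightarrow> gr (flat {1..k} M) \<in> \<A>0 k"
  unfolding \<A>0_def by (intro span_base) (simp add: labeled_graphs_def labels_flat all_labeled_flat)

lemma mult_edgeless_in_A0: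
  assumes "b \<in> \<A>0 k" "k \<le> l" shows "b * edgeless l \<in> \<A>0 l"
proof -
  show ?thesis
  proof (rule span_induct[OF assms(1)[unfolded \<A>0_def]])
    show "subspace {b. b * edgeless l \<in> \<A>0 l}"
      using linear_subspace_vimage[OF linear_mult_right subspace_A0] by (simp add: vimage_def)
    fix x assume "x \<in> gr ` {G \<in> labeled_graphs k. all_labeled G}"
    then obtain G where G: "x = gr G" "labels G = {1..k}" "all_labeled G"
      by (auto simp: labeled_graphs_def)
    then have "G + flat {1..l} {#} \<in> {G \<in> labeled_graphs l. all_labeled G}"
      using \<open>k \<le> l\<close> by (auto simp: labeled_graphs_def labels_plus labels_flat all_labeled_plus all_labeled_flat)
    then show "x * edgeless l \<in> \<A>0 l"
      by (auto simp: G(1) edgeless_def gr_mult \<A>0_def intro: span_base)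
  qed
qed

text \<open>
  These cones increase with \<open>k\<close>: multiplication by the unit of a larger \<open>\<A>0 l\<close>, which is
  idempotent, carries squares to squares.
\<close>

definition sos_class :: "nat \<Rightarrow> graph_algebra set" where
  "sos_class k = {x. \<exists>s\<in>sums_of_squares (\<A>0 k). coincide x s}"

lemma sos_class_coincide: "x \<in> sos_class k \<Longrightarrow> coincide y x \<Longrightarrow> y \<in> sos_class k"
  unfolding sos_class_def using coincide_trans by blast

lemma sos_class_zero: "0 \<in> sos_class k"
  unfolding sos_class_def sums_of_squares_def using coincide_refl
  by (auto intro!: exI[of _ "[]"])

lemma sos_class_square: "b \<in> \<A>0 k \<Longrightarrow> b\<^sup>2 \<in> sos_class k"
  unfolding sos_class_def sums_of_squares_def using coincide_refl
  by (auto intro!: exI[of _ "[b]"] exI[of _ "b\<^sup>2"])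

lemma sos_class_add:
  assumes "x \<in> sos_class k" "y \<in> sos_class k" shows "x + y \<in> sos_class k"
proof -
  obtain bs cs where "set bs \<subseteq> \<A>0 k" "set cs \<subseteq> \<A>0 k"
    "coincide x (\<Sum>b\<leftarrow>bs. b\<^sup>2)" "coincide y (\<Sum>b\<leftarrow>cs. b\<^sup>2)"
    using assms unfolding sos_class_def sums_of_squares_def by blast
  then have "set (bs @ cs) \<subseteq> \<A>0 k" "coincide (x + y) (\<Sum>b\<leftarrow>bs @ cs. b\<^sup>2)"
    using coincide_add by auto
  then show ?thesis unfolding sos_class_def sums_of_squares_def by blast
qed

lemma scaleR_square: "(c *\<^sub>R b)\<^sup>2 = c\<^sup>2 *\<^sub>R (b\<^sup>2 :: graph_algebra)"
  by (simp add: power2_eq_square scaleR_mult_left mult.commute[of b "_ *\<^sub>R _"])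

lemma sos_class_scaleR:
  assumes "x \<in> sos_class k" "0 \<le> c" shows "c *\<^sub>R x \<in> sos_class k"
proof -
  obtain bs where bs: "set bs \<subseteq> \<A>0 k" "coincide x (\<Sum>b\<leftarrow>bs. b\<^sup>2)"
    using assms unfolding sos_class_def sums_of_squares_def by blast
  let ?cs = "map (\<lambda>b. sqrt c *\<^sub>R b) bs"
  have "(\<Sum>b\<leftarrow>?cs. b\<^sup>2) = c *\<^sub>R (\<Sum>b\<leftarrow>bs. b\<^sup>2)"
    using \<open>0 \<le> c\<close> by (induction bs) (simp_all add: scaleR_square scaleR_add_right)
  then have "coincide (c *\<^sub>R x) (\<Sum>b\<leftarrow>?cs. b\<^sup>2)" using coincide_scaleR[OF bs(2)] by metis
  moreover have "set ?cs \<subseteq> \<A>0 k" using bs(1) subspace_scale[OF subspace_A0] by auto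
  ultimately show ?thesis unfolding sos_class_def sums_of_squares_def by blast
qed

lemma sos_class_mono:
  assumes "x \<in> sos_class k" "k \<le> l" shows "x \<in> sos_class l"
proof -
  obtain bs where bs: "set bs \<subseteq> \<A>0 k" "coincide x (\<Sum>b\<leftarrow>bs. b\<^sup>2)"
    using assms unfolding sos_class_def sums_of_squares_def by blast
  let ?cs = "map (\<lambda>b. b * edgeless l) bs"
  have "(edgeless l)\<^sup>2 = edgeless l" by (simp add: power2_eq_square edgeless_mult)
  then have "(b * edgeless l)\<^sup>2 = b\<^sup>2 * edgeless l" for b
    by (simp add: power_mult_distrib)
  then have "(\<Sum>b\<leftarrow>?cs. b\<^sup>2) = (\<Sum>b\<leftarrow>bs. b\<^sup>2) * edgeless l"
    by (simp add: sum_list_mult_const comp_def)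
  then have "coincide x (\<Sum>b\<leftarrow>?cs. b\<^sup>2)"
    using coincide_trans[OF bs(2) coincide_sym[OF coincide_edgeless]] by simp
  moreover have "set ?cs \<subseteq> \<A>0 l" using bs(1) mult_edgeless_in_A0 \<open>k \<le> l\<close> by auto
  ultimately show ?thesis unfolding sos_class_def sums_of_squares_def by blast
qed

lemma sos_class_add_max:
  "x \<in> sos_class k \<Longrightarrow> y \<in> sos_class l \<Longrightarrow> x + y \<in> sos_class (max k l)"
  by (meson sos_class_add sos_class_mono max.cobounded1 max.cobounded2)

lemma replicate_mset_add: "replicate_mset (m + n) a = replicate_mset m a + replicate_mset n a"
  by (induction m) simp_all

text \<open>Up to labels, \<open>K\<^sub>2\<close> with \<open>2 * n\<close> edges is the square of the monomial \<open>z\<^sub>1\<^sub>2 ^ n\<close>.\<close>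

lemma sos_class_K2: "gr (K2 (2 * n)) \<in> sos_class 2"
proof -
  let ?e = "{1..2} :: nat set"
  have e: "card ?e = 2" "valid_edges ?e (replicate_mset n ?e)" by (auto simp: valid_edges_def)
  then have "(gr (flat ?e (replicate_mset n ?e)))\<^sup>2 = gr (flat ?e (replicate_mset (2 * n) ?e))"
    by (simp add: power2_eq_square gr_mult flat_plus mult_2 replicate_mset_add)
  then have "gr (flat ?e (replicate_mset (2 * n) ?e)) \<in> sos_class 2"
    using sos_class_square[OF flat_in_A0[OF e(2)]] by simp
  then show ?thesis
    by (rule sos_class_coincide)
      (rule coincide_unlabel, simp add: unlabel_edge[OF e(1)] flip: unlabel_edge[OF e(1)])
qed

section \<open>The cone with the exponential order unit\<close>

definition theta :: "nat \<Rightarrow> graph_algebra" where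
  "theta r = (\<Sum>i=0..r. (1 / fact i) *\<^sub>R gr (K2 (2 * i)))"

lemma sos_class_sum_K2:
  "finite A \<Longrightarrow> (\<Sum>i\<in>A. (1 / fact i) *\<^sub>R gr (K2 (2 * i))) \<in> sos_class 2"
  by (induction A rule: finite_induct)
    (auto intro!: sos_class_zero sos_class_add sos_class_scaleR sos_class_K2)

lemma theta_diff: "r \<le> s \<Longrightarrow> theta s - theta r \<in> sos_class 2"
proof -
  assume "r \<le> s"
  then have "theta s - theta r = (\<Sum>i\<in>{0..s} - {0..r}. (1 / fact i) *\<^sub>R gr (K2 (2 * i)))"
    unfolding theta_def by (subst sum_diff) auto
  then show ?thesis using sos_class_sum_K2 by simp
qed

text \<open>
  A cone in the product of the graph algebra and the real line, where the element \<open>(0, 1)\<close> plays the part of the divergent infinite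
  sum \<open>theta \<infinity>\<close>: the pair \<open>(x, c)\<close> stands for \<open>x + c *\<^sub>R theta \<infinity>\<close>, and it lies in the
  cone generated by the sums of squares and by all \<open>theta \<infinity> - theta r\<close>. As the differences
  \<open>theta s - theta r\<close> for \<open>r \<le> s\<close> are sums of squares up to coincidence, this cone has the
  following form. The choice of \<open>r\<close> is immaterial as long as it is large.
\<close>

definition theta_cone :: "(graph_algebra \<times> real) set" where
  "theta_cone = {(x, c). 0 \<le> c \<and> (\<exists>r k. x + c *\<^sub>R theta r \<in> sos_class k)}"

lemma theta_coneI: "0 \<le> c \<Longrightarrow> x + c *\<^sub>R theta r \<in> sos_class k \<Longrightarrow> (x, c) \<in> theta_cone"
  unfolding theta_cone_def by blast

lemma sos_class_theta_mono:
  assumes "x + c *\<^sub>R theta r \<in> sos_class k" "r \<le> s" "0 \<le> c"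
  shows "x + c *\<^sub>R theta s \<in> sos_class (max k 2)"
proof -
  have "(x + c *\<^sub>R theta r) + c *\<^sub>R (theta s - theta r) \<in> sos_class (max k 2)"
    using assms by (intro sos_class_add_max sos_class_scaleR theta_diff)
  then show ?thesis by (simp add: scaleR_diff_right)
qed

lemma theta_cone_coincide: "(x, c) \<in> theta_cone \<Longrightarrow> coincide y x \<Longrightarrow> (y, c) \<in> theta_cone"
  unfolding theta_cone_def using coincide_add[OF _ coincide_refl] sos_class_coincide by blast

lemma convex_cone_theta_cone: "convex_cone theta_cone"
  unfolding convex_cone_iff
proof (intro conjI ballI allI impI)
  show "0 \<in> theta_cone"
    unfolding zero_prod_def by (rule theta_coneI[of _ _ 0 0]) (simp_all add: sos_class_zero)
next
  fix p q assume "p \<in> theta_cone" "q \<in> theta_cone"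
  then obtain x c r k y d s l where p: "p = (x, c)" "0 \<le> c" "x + c *\<^sub>R theta r \<in> sos_class k"
    and q: "q = (y, d)" "0 \<le> d" "y + d *\<^sub>R theta s \<in> sos_class l"
    unfolding theta_cone_def by blast
  have "(x + c *\<^sub>R theta (max r s)) + (y + d *\<^sub>R theta (max r s)) \<in> sos_class (max (max k 2) (max l 2))"
    using p q by (intro sos_class_add_max sos_class_theta_mono[of _ _ r] sos_class_theta_mono[of _ _ s]) auto
  then have "(x + y) + (c + d) *\<^sub>R theta (max r s) \<in> sos_class (max (max k 2) (max l 2))"
    by (simp add: algebra_simps)
  then show "p + q \<in> theta_cone" using p q by (auto intro!: theta_coneI)
next
  fix p and e :: real assume "p \<in> theta_cone" and e: "0 \<le> e"
  then obtain x c r k where p: "p = (x, c)" "0 \<le> c" "x + c *\<^sub>R theta r \<in> sos_class k"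
    unfolding theta_cone_def by blast
  then have "e *\<^sub>R (x + c *\<^sub>R theta r) \<in> sos_class k" using e by (intro sos_class_scaleR)
  then show "e *\<^sub>R p \<in> theta_cone"
    using p e by (auto intro!: theta_coneI[of _ _ r k] simp: scaleR_add_right)
qed

lemmas theta_cone_add = convex_cone_add[OF convex_cone_theta_cone]
lemmas theta_cone_scaleR = convex_cone_scaleR[OF convex_cone_theta_cone]

lemma theta_cone_sos: "x \<in> sos_class k \<Longrightarrow> (x, 0) \<in> theta_cone"
  by (rule theta_coneI[of _ _ 0]) simp_all

lemma theta_cone_minus_K2: "(- gr (K2 (2 * n)), fact n) \<in> theta_cone"
proof (rule theta_coneI)
  have "theta n = (\<Sum>i<n. (1 / fact i) *\<^sub>R gr (K2 (2 * i))) + (1 / fact n) *\<^sub>R gr (K2 (2 * n))"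
    unfolding theta_def atLeast0AtMost lessThan_Suc_atMost[symmetric] by simp
  then have "- gr (K2 (2 * n)) + fact n *\<^sub>R theta n =
      fact n *\<^sub>R (\<Sum>i<n. (1 / fact i) *\<^sub>R gr (K2 (2 * i)))"
    by (simp add: scaleR_add_right)
  then show "- gr (K2 (2 * n)) + fact n *\<^sub>R theta n \<in> sos_class 2"
    by (simp add: sos_class_scaleR sos_class_sum_K2)
qed simp

lemma coincide_K2_0: "coincide (edgeless k) (gr (K2 0))"
proof -
  have "coincide (edgeless k) 1" for k
    using coincide_edgeless[of 1 k] by simp
  moreover have "coincide (edgeless 2) (gr (K2 0))"
    unfolding edgeless_def using unlabel_edge[of "{1..2}" 0]
    by (intro coincide_unlabel) (simp flip: unlabel_edge[of "{1..2}" 0])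
  ultimately show ?thesis using coincide_trans coincide_sym by metis
qed

text \<open>
  A product of even powers of edges is bounded by \<open>theta\<close>. The inequality
  \<open>2 * X * Y \<le> X\<^sup>2 + Y\<^sup>2\<close> splits off one edge, at the price of doubling the exponents; hence the
  claim is made for all \<open>n\<close> at once. It ends with even powers of a single edge, which up to
  coincidence are multiples of the terms of \<open>theta\<close>.
\<close>

lemma theta_cone_minus_power:
  assumes "valid_edges {1..k} M"
  shows "\<exists>c. (- gr (flat {1..k} (repeat_mset (2 * n) M)), c) \<in> theta_cone"
  using assms
proof (induction M arbitrary: n)
  case empty
  have "(- edgeless k, fact 0) \<in> theta_cone"
    by (rule theta_cone_coincide[OF theta_cone_minus_K2]) (simp add: coincide_minus coincide_K2_0)
  then show ?case by (auto simp: edgeless_def)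
next
  case (add e M)
  let ?V = "{1..k}"
  have e: "e \<subseteq> ?V" "card e = 2" and M: "valid_edges ?V M"
    using add.prems by auto
  have ve: "valid_edges e (replicate_mset m e)" for m
    using e by (auto simp: valid_edges_def intro: finite_subset)
  have vM: "valid_edges ?V (repeat_mset m M)" for m using M by (rule valid_edges_repeat)
  \<comment> \<open>The \<open>m\<close>-th powers of \<open>e\<close> and of \<open>M\<close>.\<close>
  define X where "X m = gr (flat ?V (replicate_mset m e))" for m
  define Y where "Y m = gr (flat ?V (repeat_mset m M))" for m
  have vX: "valid_edges ?V (replicate_mset m e)" for m
    using valid_edges_mono[OF ve e(1)] by simp
  have X2: "(X m)\<^sup>2 = X (2 * m)" for m
    using vX by (simp add: X_def power2_eq_square gr_mult flat_plus mult_2 replicate_mset_add)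
  have Y2: "(Y m)\<^sup>2 = Y (2 * m)" for m
    using vM by (simp add: Y_def power2_eq_square gr_mult flat_plus mult_2 repeat_mset_distrib)
  have XY: "X m * Y m = gr (flat ?V (repeat_mset m (add_mset e M)))" for m
    using vX vM by (simp add: X_def Y_def gr_mult flat_plus)
  have "X m = gr (flat e (replicate_mset m e)) * edgeless k" for m
    using ve e by (simp add: X_def edgeless_def gr_mult flat_plus Un_absorb1)
  then have "coincide (X m) (gr (K2 m))" for m
    using coincide_trans[OF coincide_edgeless coincide_unlabel] unlabel_edge[OF e(2)]
    by (metis unlabel_unlabel)
  then have "(- X (2 * (2 * n)), fact (2 * n)) \<in> theta_cone"
    by (intro theta_cone_coincide[OF theta_cone_minus_K2] coincide_minus)
  moreover obtain c where "(- Y (2 * (2 * n)), c) \<in> theta_cone"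
    using add.IH[OF M, of "2 * n"] by (auto simp: Y_def)
  moreover have "((X (2 * n) - Y (2 * n))\<^sup>2, 0) \<in> theta_cone"
    unfolding X_def Y_def
    by (intro theta_cone_sos[OF sos_class_square[where k = k]] subspace_diff[OF subspace_A0] flat_in_A0 vX vM)
  ultimately have "(1/2) *\<^sub>R ((X (2 * n) - Y (2 * n))\<^sup>2, 0) + (1/2) *\<^sub>R ((- X (2 * (2 * n)), fact (2 * n)) +
      (- Y (2 * (2 * n)), c)) \<in> theta_cone"
    by (intro theta_cone_add theta_cone_scaleR) auto
  also have "(1/2) *\<^sub>R ((X (2 * n) - Y (2 * n))\<^sup>2, 0) + (1/2) *\<^sub>R ((- X (2 * (2 * n)), fact (2 * n)) +
      (- Y (2 * (2 * n)), c)) = (- (X (2 * n) * Y (2 * n)), (fact (2 * n) + c) / 2)"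
  proof -
    have "(X (2 * n) - Y (2 * n))\<^sup>2 + (- X (2 * (2 * n)) + - Y (2 * (2 * n))) = 2 *\<^sub>R - (X (2 * n) * Y (2 * n))"
      unfolding X2[symmetric] Y2[symmetric] by (simp add: power2_eq_square algebra_simps scaleR_2)
    then have "(1/2) *\<^sub>R ((X (2 * n) - Y (2 * n))\<^sup>2 + (- X (2 * (2 * n)) + - Y (2 * (2 * n)))) = - (X (2 * n) * Y (2 * n))"
      by (simp only: scaleR_scaleR) simp
    then show ?thesis by (simp add: scaleR_add_right)
  qed
  finally show ?case unfolding XY by blast
qed

text \<open>
  For a monomial \<open>X\<close> the squares of \<open>X + 1\<close> and \<open>X - 1\<close> bound \<open>- 2 * X\<close> and \<open>2 * X\<close> by
  \<open>X\<^sup>2 + 1\<close>, and \<open>X\<^sup>2\<close> has only even powers.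
\<close>

lemma theta_cone_gr: "\<exists>c. (gr G, c) \<in> theta_cone" "\<exists>c. (- gr G, c) \<in> theta_cone"
proof -
  obtain k M where M: "valid_edges {1..k} M" "unlabel (flat {1..k} M) = unlabel G"
    by (rule ex_flat_unlabel)
  define X where "X = gr (flat {1..k} M)"
  have G: "coincide (gr G) X" unfolding X_def using M(2) by (intro coincide_unlabel) simp
  have X: "X \<in> \<A>0 k" and E: "edgeless k \<in> \<A>0 k"
    unfolding X_def edgeless_def using M(1) by (intro flat_in_A0, simp)+
  have XE: "X * edgeless k = X" "edgeless k * X = X"
    using M(1) by (simp_all add: X_def edgeless_def gr_mult flat_plus)
  have EE: "edgeless k * edgeless k = edgeless k" by (simp add: edgeless_mult)
  have "X\<^sup>2 = gr (flat {1..k} (repeat_mset (2 * 1) M))"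
    using M(1) by (simp add: X_def power2_eq_square gr_mult flat_plus numeral_2_eq_2)
  then obtain c where c: "(- X\<^sup>2, c) \<in> theta_cone"
    using theta_cone_minus_power[OF M(1), of 1] by auto
  obtain d where d: "(- edgeless k, d) \<in> theta_cone"
    using theta_cone_minus_power[of k "{#}" 0] by (auto simp: edgeless_def)
  \<comment> \<open>\<open>e\<close> is a sign; \<open>edgeless k\<close> is the unit of \<open>\<A>0 k\<close>.\<close>
  have key: "(e *\<^sub>R X, (c + d) / 2) \<in> theta_cone" if "e\<^sup>2 = 1" for e :: real
  proof -
    have "(1/2) *\<^sub>R (((e *\<^sub>R X + edgeless k)\<^sup>2, 0) + ((- X\<^sup>2, c) + (- edgeless k, d))) \<in> theta_cone"
      using c d by (intro theta_cone_add theta_cone_scaleR theta_cone_sos[OF sos_class_square[where k = k]]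
        subspace_add[OF subspace_A0] subspace_scale[OF subspace_A0] X E) auto
    moreover have "(e *\<^sub>R X + edgeless k)\<^sup>2 = X\<^sup>2 + edgeless k + 2 *\<^sub>R (e *\<^sub>R X)"
    proof -
      have "(e *\<^sub>R X + edgeless k)\<^sup>2 = (e *\<^sub>R X)\<^sup>2 + edgeless k * edgeless k + ((e *\<^sub>R X) * edgeless k + (e *\<^sub>R X) * edgeless k)"
        by (simp add: power2_eq_square algebra_simps)
      then show ?thesis
        by (simp only: scaleR_square that scaleR_mult_left XE EE scaleR_2) simp
    qed
    ultimately show ?thesis by simp
  qed
  have "(X, (c + d) / 2) \<in> theta_cone" "(- X, (c + d) / 2) \<in> theta_cone"
    using key[of 1] key[of "-1"] by simp_all
  then show "\<exists>c. (gr G, c) \<in> theta_cone" "\<exists>c. (- gr G, c) \<in> theta_cone"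
    using theta_cone_coincide G coincide_minus[OF G] by blast+
qed

lemma order_unit_in_theta_cone: "(0, 1) \<in> theta_cone"
  using sos_class_K2[of 0] by (intro theta_coneI[of _ _ 0 2]) (simp_all add: theta_def)

text \<open>The elements that are bounded from both sides form a subspace, which contains all graphs.\<close>

lemma theta_cone_order_unit: "\<exists>c. p + c *\<^sub>R (0, 1) \<in> theta_cone"
proof -
  let ?S = "{x. (\<exists>c. (x, c) \<in> theta_cone) \<and> (\<exists>c. (- x, c) \<in> theta_cone)}"
  have "subspace ?S"
  proof (rule subspaceI)
    show "0 \<in> ?S" using theta_cone_sos[OF sos_class_zero] by auto
  next
    fix x y assume "x \<in> ?S" "y \<in> ?S"
    then show "x + y \<in> ?S" using theta_cone_add by fastforce
  next
    have *: "\<exists>c. (e *\<^sub>R x, c) \<in> theta_cone" if "\<exists>c. (x, c) \<in> theta_cone" "0 \<le> e" for e x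
      using that theta_cone_scaleR[where c = e] by fastforce
    fix x and e :: real assume x: "x \<in> ?S"
    show "e *\<^sub>R x \<in> ?S"
      using x *[of x e] *[of "- x" e] *[of x "- e"] *[of "- x" "- e"]
      by (cases "0 \<le> e") auto
  qed
  then have "fst p \<in> ?S"
    using span_induct[OF span_gr[of "fst p"], of "\<lambda>x. x \<in> ?S"] theta_cone_gr by auto
  then obtain c where "(fst p, c) \<in> theta_cone" by blast
  then have "p + (c - snd p) *\<^sub>R (0, 1) \<in> theta_cone" by (cases p) simp
  then show ?thesis by blast
qed

section \<open>Graph parameters and positive functionals\<close>

text \<open>
  The parameter is isolate indifferent because elements that coincide with \<open>0\<close> lie in the cone
  together with their negatives, reflection positive because the cone contains the squares, and
  slowly growing because it contains \<open>(- theta n, 1)\<close>, so that the partial sums of the series are at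
  most \<open>L (0, 1)\<close>.
\<close>

lemma positive_parameter_from_functional:
  assumes L: "linear L" and pos: "\<And>p. p \<in> theta_cone \<Longrightarrow> 0 \<le> L p"
    and unit: "L (0, 1) = 1"
  defines "t \<equiv> \<lambda>G. L (gr G, 0)"
  shows "isolate_indifferent t" "flatly_reflection_positive t" "slowly_growing t"
    and "extend t x = L (x, 0)"
proof -
  have lin: "linear (\<lambda>x. L (x, 0))"
  proof (rule linearI)
    show "L (x + y, 0) = L (x, 0) + L (y, 0)" for x y
      using linear_add[OF L, of "(x, 0)" "(y, 0)"] by simp
    show "L (c *\<^sub>R x, 0) = c *\<^sub>R L (x, 0)" for c x
      using linear_scale[OF L, of c "(x, 0)"] by simp
  qed
  have coinc: "L (x, 0) = L (y, 0)" if "coincide x y" for x y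
  proof -
    have "0 \<le> L (x - y, 0)" if "coincide x y" for x y
      using that coincide_add[OF that coincide_refl, of "- y"]
      by (intro pos theta_cone_sos[OF sos_class_coincide[OF sos_class_zero]]) simp
    from this[OF that] this[OF coincide_sym[OF that]] show ?thesis
      by (simp add: linear_diff[OF lin])
  qed
  show ext: "extend t x = L (x, 0)" for x
  proof (rule linear_eq_gr[OF linear_extend lin])
    show "extend t (gr G) = L (gr G, 0)" for G
      unfolding extend_gr t_def by (rule coinc[OF coincide_unlabel]) simp
  qed
  show "isolate_indifferent t"
    unfolding isolate_indifferent_def
  proof
    fix G assume G: "G \<in> labeled_graphs 0"
    have "unlabel (G + flat {1} {#}) = G + K1"
      using unlabel_plus_isolated_label[of 1 G] unlabel_unlabeled[OF G] G
      by (simp add: labeled_graphs_def)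
    then have "coincide (gr (G + K1)) (gr (G + flat {1} {#}))"
      by (intro coincide_unlabel) (metis unlabel_unlabel)
    also have "coincide (gr (G + flat {1} {#})) (gr G)" by (rule coincide_isolated_label)
    finally show "t (G + K1) = t G" unfolding t_def by (rule coinc)
  qed
  show "flatly_reflection_positive t"
    unfolding flatly_reflection_positive_def ext
    by (intro allI ballI pos theta_cone_sos[OF sos_class_square])
  have K2_nonneg: "0 \<le> t (K2 (2 * i))" for i
    unfolding t_def by (intro pos theta_cone_sos[OF sos_class_K2])
  have "(\<Sum>i<n. 1 / fact i * t (K2 (2 * i))) \<le> 1" for n
  proof -
    have "(- theta n, 1) \<in> theta_cone"
      by (rule theta_coneI[of _ _ n 0]) (simp_all add: sos_class_zero)
    then have "0 \<le> L (- theta n, 1)" by (rule pos)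
    also have "L (- theta n, 1) = L (0, 1) - L (theta n, 0)"
      by (simp flip: linear_diff[OF L])
    finally have "L (theta n, 0) \<le> 1" by (simp add: unit)
    moreover have "L (theta n, 0) = (\<Sum>i=0..n. 1 / fact i * t (K2 (2 * i)))"
      by (simp add: theta_def t_def linear_sum[OF lin] linear_scale[OF lin])
    moreover have "(\<Sum>i<n. 1 / fact i * t (K2 (2 * i))) \<le> (\<Sum>i=0..n. 1 / fact i * t (K2 (2 * i)))"
      by (intro sum_mono2) (auto simp: K2_nonneg)
    ultimately show ?thesis by simp
  qed
  then show "slowly_growing t"
    unfolding slowly_growing_def by (intro summableI_nonneg_bounded) (simp_all add: K2_nonneg)
qed

lemma extend_sos_class:
  assumes t: "isolate_indifferent t" "flatly_reflection_positive t" and x: "x \<in> sos_class k"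
  shows "0 \<le> extend t x"
proof -
  obtain bs where bs: "set bs \<subseteq> \<A>0 k" "coincide x (\<Sum>b\<leftarrow>bs. b\<^sup>2)"
    using x unfolding sos_class_def sums_of_squares_def by blast
  have "0 \<le> extend t (\<Sum>b\<leftarrow>bs. b\<^sup>2)"
    using bs(1) t(2) by (induction bs)
      (auto simp: linear_0[OF linear_extend] linear_add[OF linear_extend] flatly_reflection_positive_def)
  then show ?thesis using extend_coincide[OF t(1) bs(2)] by simp
qed

theorem theorem3p6:
  fixes a :: graph_algebra
  assumes "a \<in> \<A> 0"
  shows "(\<forall>t. isolate_indifferent t \<and> flatly_reflection_positive t \<and> slowly_growing t
             \<longrightarrow> extend t a \<ge> 0) \<longleftrightarrow>
         (\<forall>\<epsilon>>0. \<exists>r. \<exists>s\<in>sums_of_squares (\<A>0 r).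
             coincide (a + \<epsilon> *\<^sub>R (\<Sum>i=0..r. (1 / fact i) *\<^sub>R gr (K2 (2 * i)))) s)"
proof -
  have "(\<forall>t. isolate_indifferent t \<and> flatly_reflection_positive t \<and> slowly_growing t
             \<longrightarrow> extend t a \<ge> 0) \<longleftrightarrow> (\<forall>\<epsilon>>0. \<exists>r. a + \<epsilon> *\<^sub>R theta r \<in> sos_class r)"
  proof (intro iffI allI impI; (elim conjE)?)
    fix t assume approx: "\<forall>\<epsilon>>0. \<exists>r. a + \<epsilon> *\<^sub>R theta r \<in> sos_class r"
      and t: "isolate_indifferent t" "flatly_reflection_positive t" "slowly_growing t"
    let ?f = "\<lambda>i. 1 / fact i * t (K2 (2 * i))"
    \<comment> \<open>\<open>K2 n\<close> has no labels; this is visible once it is written as \<open>unlabel\<close> of some graph.\<close>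
    have K2: "extend t (gr (K2 n)) = t (K2 n)" for n
      using unlabel_edge[of "{0, 1}" n] by (metis extend_gr unlabel_unlabel card_2_iff zero_neq_one)
    have f: "summable ?f" "0 \<le> ?f i" for i
      using t(3) extend_sos_class[OF t(1,2) sos_class_K2, of i] by (simp_all add: slowly_growing_def K2)
    have bound: "0 \<le> extend t a + \<epsilon> * suminf ?f" if \<epsilon>: "\<epsilon> > 0" for \<epsilon>
    proof -
      obtain r where "a + \<epsilon> *\<^sub>R theta r \<in> sos_class r" using approx \<epsilon> by blast
      then have "0 \<le> extend t (a + \<epsilon> *\<^sub>R theta r)" by (rule extend_sos_class[OF t(1,2)])
      also have "\<dots> = extend t a + \<epsilon> * (\<Sum>i=0..r. ?f i)"
        by (simp add: theta_def linear_add[OF linear_extend] linear_scale[OF linear_extend]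
            linear_sum[OF linear_extend] K2)
      also have "\<dots> \<le> extend t a + \<epsilon> * suminf ?f"
        using f \<epsilon> by (intro add_left_mono mult_left_mono sum_le_suminf) auto
      finally show ?thesis .
    qed
    show "0 \<le> extend t a"
    proof (rule field_le_epsilon)
      fix e :: real assume "e > 0"
      \<comment> \<open>The denominator is \<open>suminf ?f + 1\<close> because the sum can be \<open>0\<close>.\<close>
      have S: "0 \<le> suminf ?f" using f by (intro suminf_nonneg)
      have "e / (suminf ?f + 1) * suminf ?f \<le> e"
        using \<open>e > 0\<close> S by (simp add: field_simps)
      then show "0 \<le> extend t a + e"
        using bound[of "e / (suminf ?f + 1)"] \<open>e > 0\<close> S by simp
    qed
  next
    fix \<epsilon> :: real
    assume nonneg: "\<forall>t. isolate_indifferent t \<and> flatly_reflection_positive t \<and> slowly_growing t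
             \<longrightarrow> extend t a \<ge> 0" and \<epsilon>: "\<epsilon> > 0"
    have "(a, \<epsilon>) \<in> theta_cone"
    proof (rule ccontr)
      assume notin: "(a, \<epsilon>) \<notin> theta_cone"
      obtain L :: "graph_algebra \<times> real \<Rightarrow> real"
        where L: "linear L" "\<forall>p\<in>theta_cone. 0 \<le> L p" "L (0, 1) = 1"
        "L (a, \<epsilon>) \<le> 0"
        using separation_of_point_from_cone[OF convex_cone_theta_cone order_unit_in_theta_cone
            theta_cone_order_unit notin] by blast
      note t = positive_parameter_from_functional[OF L(1) bspec[OF L(2)] L(3)]
      have "L (a, \<epsilon>) = L (a, 0) + \<epsilon> * L (0, 1)"
        by (simp flip: linear_scale[OF L(1), simplified] linear_add[OF L(1)])
      moreover have "0 \<le> L (a, 0)" using nonneg t by metis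
      ultimately show False using L(3,4) \<epsilon> by simp
    qed
    then obtain r k where "a + \<epsilon> *\<^sub>R theta r \<in> sos_class k"
      unfolding theta_cone_def by blast
    \<comment> \<open>The number of labels and the index of \<open>theta\<close> are raised to a common value; two labels
      are needed for the new terms of \<open>theta\<close>.\<close>
    then have "a + \<epsilon> *\<^sub>R theta (max r (max k 2)) \<in> sos_class (max k 2)"
      using \<epsilon> by (intro sos_class_theta_mono[of _ _ r]) auto
    then have "a + \<epsilon> *\<^sub>R theta (max r (max k 2)) \<in> sos_class (max r (max k 2))"
      by (rule sos_class_mono) simp
    then show "\<exists>r. a + \<epsilon> *\<^sub>R theta r \<in> sos_class r" by blast
  qed
  then show ?thesis by (simp only: theta_def sos_class_def mem_Collect_eq)
qed

end
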